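(* Let $q\in[0,1]$, and let $\alpha\in(0,1]$ and $\beta\in(0,1)$ be constants. For each $n$ let $m=\alpha n$ and $k=\beta n$ (rounded to integers), and let $A$ be an $m\times n$ random matrix with i.i.d. standard normal entries. Let $h$ be a standard normal random variable, and for $\nu\ge 0,\gamma\ge 0$ define \[ I^{(1)}_{sec}(\nu,\gamma)=\mathbb{E}\max_{w\in\mathbb{R}}\Big(|h||w|+\nu|w|^q-\gamma w^2\Big),\qquad I^{(2)}_{sec}(\nu,\gamma)=\mathbb{E}\max_{w\in\mathbb{R}}\Big(|h||w|-\nu|w|^q-\gamma w^2\Big). \] Suppose \[ \min_{\gamma\ge 0,\ \nu\ge 0}\Big(\beta I^{(1)}_{sec}(\nu,\gamma)+(1-\beta)I^{(2)}_{sec}(\nu,\gamma)+\gamma\Big)<\sqrt{\alpha}. \] Then with overwhelming probability the following holds: for every vector $\tilde x\in\mathbb{R}^n$ with $\tilde x_1=\dots=\tilde x_{n-k}=0$, setting $y=A\tilde x$, the (unique) solution of $\min\{\|x\|_q^q : Ax=y\}$ is $\tilde x$.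
   Context: For $q\in(0,1]$, $\|x\|_q^q=\sum_i|x_i|^q$; for $q=0$ one uses the convention $|t|^0=1$ if $t\neq0$ and $0^0=0$, so that $\|x\|_0$ counts nonzero entries. "With overwhelming probability" means with probability at least $1-\epsilon_n$, where $\epsilon_n$ decays exponentially in $n$ as $n\to\infty$. *)

theory Defs
  imports "HOL-Probability.Probability"
begin

definition gauss :: "real measure" where
  "gauss = density lborel std_normal_density"

definition qpow :: "real \<Rightarrow> real \<Rightarrow> real" where
  "qpow q t = (if q = 0 then (if t = 0 then 0 else 1) else \<bar>t\<bar> powr q)"

definition lqq :: "real \<Rightarrow> nat \<Rightarrow> (nat \<Rightarrow> real) \<Rightarrow> real" where
  "lqq q n x = (\<Sum>i<n. qpow q (x i))"

definition matvec :: "nat \<Rightarrow> (nat \<times> nat \<Rightarrow> real) \<Rightarrow> (nat \<Rightarrow> real) \<Rightarrow> nat \<Rightarrow> real" where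
  "matvec n A x i = (\<Sum>j<n. A (i, j) * x j)"

definition gauss_matrix :: "nat \<Rightarrow> nat \<Rightarrow> (nat \<times> nat \<Rightarrow> real) measure" where
  "gauss_matrix m n = PiM ({..<m} \<times> {..<n}) (\<lambda>_. gauss)"

text \<open>I^(1)_sec and I^(2)_sec. The inner max is a supremum; it is >= 0 (take w = 0),
  so truncating at 0 via ennreal does not change it; values may be infinite.\<close>
definition I1sec :: "real \<Rightarrow> real \<Rightarrow> real \<Rightarrow> ennreal" where
  "I1sec q \<nu> \<gamma> = (\<integral>\<^sup>+ h. (SUP w::real. ennreal (\<bar>h\<bar> * \<bar>w\<bar> + \<nu> * qpow q w - \<gamma> * w\<^sup>2)) \<partial>gauss)"

definition I2sec :: "real \<Rightarrow> real \<Rightarrow> real \<Rightarrow> ennreal" where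
  "I2sec q \<nu> \<gamma> = (\<integral>\<^sup>+ h. (SUP w::real. ennreal (\<bar>h\<bar> * \<bar>w\<bar> - \<nu> * qpow q w - \<gamma> * w\<^sup>2)) \<partial>gauss)"

definition recovers :: "real \<Rightarrow> nat \<Rightarrow> nat \<Rightarrow> nat \<Rightarrow> (nat \<times> nat \<Rightarrow> real) \<Rightarrow> bool" where
  "recovers q m n k A \<longleftrightarrow>
     (\<forall>xt::nat \<Rightarrow> real. (\<forall>i < n - k. xt i = 0) \<longrightarrow>
        (\<forall>x::nat \<Rightarrow> real. (\<forall>i<m. matvec n A x i = matvec n A xt i) \<longrightarrow>
            (\<exists>j<n. x j \<noteq> xt j) \<longrightarrow> lqq q n xt < lqq q n x))"

end

theory Submission
  imports Defs
begin

text \<open>If recovery fails, subadditivity of \<open>|t|^q\<close> puts a unit kernel vector of \<open>A\<close> into the set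
  \<open>T\<close> of unit vectors whose first \<open>n - k\<close> coordinates carry at most as much of
  \<open>\<Sum>\<^sub>j |w\<^sub>j|^q\<close> as the last \<open>k\<close>. Gordon's comparison in exponential form bounds the probability
  that \<open>ker A\<close> meets \<open>T\<close> by a constant times
  \<open>E exp(- c |g|) * E exp(c * max\<^sub>w\<^sub>\<in>\<^sub>T \<langle>h, w\<rangle>)\<close> with \<open>c = s * sqrt n\<close>, and no separate
  concentration of measure is needed: with multipliers \<open>\<nu>\<close> for the constraint defining \<open>T\<close> and
  \<open>\<gamma>\<close> for the norm, the maximum is at most a sum of independent terms depending on one \<open>h\<^sub>j\<close>
  each, so its exponential moment factorises and is
  \<open>exp(s n (\<beta> I1 + (1 - \<beta>) I2 + \<gamma>) + O(s\<^sup>2 n))\<close>,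
  while the first factor is about \<open>exp(- s n sqrt \<alpha>)\<close>. A small fixed \<open>s\<close> gives exponential decay.

  The comparison itself interpolates by \<open>cos \<theta>\<close> and \<open>sin \<theta>\<close> between the two Gaussian
  processes, over a finite net of \<open>T\<close> and with a smoothed norm and maximum; Gaussian
  integration by parts shows that the derivative in \<open>\<theta>\<close> is nonnegative.\<close>

section \<open>Gaussian integration by parts and interpolation\<close>

text \<open>For a single \<open>w\<close> the pair (A w, extra scalar) has the same law as the pair
  (g, \<open>\<langle>h, w\<rangle>\<close>), so a plain sum of exponentials over the net has equal
  expectations under both processes. The inequality arises only from raising this sum to a power
  \<open>r\<close> with \<open>r \<le> 1\<close>: the factor \<open>r * (r - 1)\<close> gives the
  correlations between different net points a sign. Keeping the norm itself, smoothed at the origin,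
  instead of maximising over a second sphere means that only one net is needed.

  The obstacle is the net. A kernel vector has to be moved to a net point with small image, which
  forces a mesh depending on the size of A, so the number of net points is uncontrolled and must not
  occur in the final bound. The extra scalar, which balances the variances of the two processes, is
  disposed of through its zero mean rather than by a tail estimate. Strictness of the hypothesis
  yields one fixed pair of multipliers, and there \<open>\<gamma>\<close> is positive because I1 is
  infinite at \<open>\<gamma> = 0\<close>.\<close>

lemma space_gauss [simp]: "space gauss = UNIV"
  by (simp add: gauss_def)

lemma sets_gauss [simp, measurable_cong]: "sets gauss = sets borel"
  by (simp add: gauss_def)

lemma prob_space_gauss: "prob_space gauss"
  unfolding gauss_def by (rule prob_space_normal_density) simp

interpretation gauss: prob_space gauss
  by (rule prob_space_gauss)

interpretation gauss_product: product_prob_space "\<lambda>_. gauss" UNIV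
  by unfold_locales

lemma gauss_integral:
  fixes f :: "real \<Rightarrow> real"
  assumes "f \<in> borel_measurable borel"
  shows "(\<integral>x. f x \<partial>gauss) = (\<integral>x. std_normal_density x * f x \<partial>lborel)"
  unfolding gauss_def using assms by (intro integral_real_density) auto

lemma gauss_integrable_iff:
  fixes f :: "real \<Rightarrow> real"
  assumes "f \<in> borel_measurable borel"
  shows "integrable gauss f \<longleftrightarrow> integrable lborel (\<lambda>x. std_normal_density x * f x)"
  unfolding gauss_def using assms by (intro integrable_real_density) auto

text \<open>The rate 1/4 is half of the 1/2 in the density, so the product is again Gaussian, with
  variance 2. It dominates exponentials of linear terms as well as small exponential moments of
  functions of quadratic growth.\<close>

lemma gauss_integrable_exp_square: "integrable gauss (\<lambda>x. exp (x\<^sup>2 / 4))"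
proof -
  have "std_normal_density x * exp (x\<^sup>2 / 4) = sqrt 2 * normal_density 0 (sqrt 2) x" for x
    by (simp add: normal_density_def exp_minus field_simps real_sqrt_mult flip: exp_add)
  then show ?thesis
    by (subst gauss_integrable_iff) auto
qed

lemma gauss_integrable_exp_abs: "integrable gauss (\<lambda>x. exp (K * \<bar>x\<bar>))"
proof (rule Bochner_Integration.integrable_bound)
  show "integrable gauss (\<lambda>x. exp (K\<^sup>2) * exp (x\<^sup>2 / 4))"
    using gauss_integrable_exp_square by simp
  show "AE x in gauss. norm (exp (K * \<bar>x\<bar>)) \<le> norm (exp (K\<^sup>2) * exp (x\<^sup>2 / 4))"
  proof (rule AE_I2)
    fix x :: real
    have "0 \<le> (K - \<bar>x\<bar> / 2)\<^sup>2" by simp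
    then have "K * \<bar>x\<bar> \<le> K\<^sup>2 + x\<^sup>2 / 4"
      by (simp add: power2_eq_square field_simps)
    then show "norm (exp (K * \<bar>x\<bar>)) \<le> norm (exp (K\<^sup>2) * exp (x\<^sup>2 / 4))"
      by (simp flip: exp_add)
  qed
qed simp

lemma gauss_integrable_exp_bounded:
  fixes f :: "real \<Rightarrow> real"
  assumes "f \<in> borel_measurable borel" "\<And>x. \<bar>f x\<bar> \<le> C * exp (K * \<bar>x\<bar>)"
  shows "integrable gauss f"
proof (rule Bochner_Integration.integrable_bound)
  show "integrable gauss (\<lambda>x. C * exp (K * \<bar>x\<bar>))"
    using gauss_integrable_exp_abs by simp
  show "AE x in gauss. norm (f x) \<le> norm (C * exp (K * \<bar>x\<bar>))"
    using assms(2) by (auto intro!: AE_I2 order_trans[OF _ abs_ge_self])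
qed (use assms in simp)

text \<open>Exponential growth survives multiplication by the variable at the price of one unit in
  the rate; integration by parts and the path derivative both produce such a factor.\<close>

lemma exp_bounded_mult_id:
  fixes a C K x :: real
  assumes "\<bar>a\<bar> \<le> C * exp (K * \<bar>x\<bar>)"
  shows "\<bar>x * a\<bar> \<le> C * exp ((K + 1) * \<bar>x\<bar>)"
proof -
  have "\<bar>x\<bar> \<le> exp \<bar>x\<bar>"
    using exp_ge_add_one_self[of "\<bar>x\<bar>"] by linarith
  then have "\<bar>x\<bar> * \<bar>a\<bar> \<le> exp \<bar>x\<bar> * (C * exp (K * \<bar>x\<bar>))"
    using assms by (intro mult_mono) auto
  then show ?thesis
    by (simp add: abs_mult algebra_simps exp_add)
qed

text \<open>The density has derivative \<open>- x\<close> times itself, so the derivative of density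
  times \<open>f\<close> is the difference of the two integrands. The growth bounds make both
  integrable and the boundary terms vanish.\<close>

lemma gauss_by_parts:
  fixes f f' :: "real \<Rightarrow> real"
  assumes deriv: "\<And>x. (f has_real_derivative f' x) (at x)"
    and cont: "\<And>x. isCont f' x"
    and f_bound: "\<And>x. \<bar>f x\<bar> \<le> C * exp (K * \<bar>x\<bar>)"
    and f'_bound: "\<And>x. \<bar>f' x\<bar> \<le> C * exp (K * \<bar>x\<bar>)"
  shows "(\<integral>x. x * f x \<partial>gauss) = (\<integral>x. f' x \<partial>gauss)"
proof -
  have [measurable]: "f \<in> borel_measurable borel" "f' \<in> borel_measurable borel"
    using DERIV_isCont[OF deriv] cont
    by (auto intro!: borel_measurable_continuous_onI continuous_at_imp_continuous_on)
  have int1: "integrable gauss (\<lambda>x. x * f x)"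
    by (rule gauss_integrable_exp_bounded[OF _ exp_bounded_mult_id[OF f_bound]]) simp
  have int2: "integrable gauss f'"
    by (rule gauss_integrable_exp_bounded[OF _ f'_bound]) simp
  have lint1: "integrable lborel (\<lambda>x. std_normal_density x * (x * f x))"
    using int1 by (subst (asm) gauss_integrable_iff) auto
  have lint2: "integrable lborel (\<lambda>x. std_normal_density x * f' x)"
    using int2 by (subst (asm) gauss_integrable_iff) auto
  define g where "g x = std_normal_density x * f x" for x
  define g' where "g' x = std_normal_density x * f' x - std_normal_density x * (x * f x)" for x
  have dens: "(std_normal_density has_real_derivative - x * std_normal_density x) (at x)" for x
  proof -
    define c where "c = 1 / sqrt (2 * pi)"
    have eq: "std_normal_density = (\<lambda>x. c * exp (- x\<^sup>2 / 2))"
      by (simp add: std_normal_density_def c_def fun_eq_iff)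
    show ?thesis
      unfolding eq by (auto intro!: derivative_eq_intros)
  qed
  have g_deriv: "(g has_real_derivative g' x) (at x)" for x
    unfolding g_def g'_def
    by (rule DERIV_cong[OF DERIV_mult[OF dens deriv]]) (simp add: algebra_simps)
  have g_bound: "\<bar>g x\<bar> \<le> C * exp (K * \<bar>x\<bar> - x\<^sup>2 / 2)" for x
  proof -
    have "1 / sqrt (2 * pi) \<le> 1"
      using pi_gt3 by (simp add: divide_le_eq)
    then have "std_normal_density x \<le> 1 * exp (- x\<^sup>2 / 2)"
      unfolding std_normal_density_def by (intro mult_right_mono) auto
    then have "std_normal_density x * \<bar>f x\<bar> \<le> (1 * exp (- x\<^sup>2 / 2)) * (C * exp (K * \<bar>x\<bar>))"
      using f_bound[of x] by (intro mult_mono) auto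
    moreover have "exp (K * \<bar>x\<bar> - x\<^sup>2 / 2) = exp (- x\<^sup>2 / 2) * exp (K * \<bar>x\<bar>)"
      by (simp flip: exp_add)
    ultimately show ?thesis
      by (simp add: g_def abs_mult mult.commute mult.left_commute)
  qed
  have lim: "(g \<longlongrightarrow> 0) F" if "filterlim abs at_top F" for F
  proof (rule Lim_null_comparison)
    show "\<forall>\<^sub>F x in F. norm (g x) \<le> C * exp (K * \<bar>x\<bar> - x\<^sup>2 / 2)"
      using g_bound by simp
    have "((\<lambda>x::real. C * exp (K * x - x\<^sup>2 / 2)) \<longlongrightarrow> 0) at_top"
      by real_asymp
    from filterlim_compose[OF this that] show "((\<lambda>x. C * exp (K * \<bar>x\<bar> - x\<^sup>2 / 2)) \<longlongrightarrow> 0) F"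
      by simp
  qed
  have abs_top: "filterlim (abs :: real \<Rightarrow> real) at_top at_top"
    and abs_bot: "filterlim (abs :: real \<Rightarrow> real) at_top at_bot"
    by real_asymp+
  have "(LBINT x=-\<infinity>..\<infinity>. g' x) = 0 - 0"
  proof (rule interval_integral_FTC_integrable[where F = g])
    show "(g has_vector_derivative g' x) (at x)" for x
      using g_deriv by (simp add: has_real_derivative_iff_has_vector_derivative)
    show "isCont g' x" for x
      unfolding g'_def using cont DERIV_isCont[OF deriv] DERIV_isCont[OF dens]
      by (intro continuous_intros)
    show "set_integrable lborel (einterval (-\<infinity>) \<infinity>) g'"
      using lint1 lint2 by (simp add: set_integrable_def g'_def)
    show "((g \<circ> real_of_ereal) \<longlongrightarrow> 0) (at_right (-\<infinity>))" "((g \<circ> real_of_ereal) \<longlongrightarrow> 0) (at_left \<infinity>)"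
      by (auto simp: ereal_tendsto_simps1 intro!: lim abs_top abs_bot)
  qed auto
  then have "(\<integral>x. g' x \<partial>lborel) = 0"
    by (simp add: interval_lebesgue_integral_def set_lebesgue_integral_def)
  then show ?thesis
    unfolding g'_def using lint1 lint2 by (simp add: gauss_integral)
qed

text \<open>The mean value theorem bounds the difference quotients by \<open>B\<close>, and
  dominated convergence applies along every sequence tending to \<open>t\<close>. The bound is
  global in \<open>t\<close>, so no neighbourhood has to be chosen.\<close>

lemma has_real_derivative_integral:
  fixes F F' :: "real \<Rightarrow> 'a \<Rightarrow> real"
  assumes deriv: "\<And>t x. x \<in> space M \<Longrightarrow> ((\<lambda>t. F t x) has_real_derivative F' t x) (at t)"
    and bound: "\<And>t x. x \<in> space M \<Longrightarrow> \<bar>F' t x\<bar> \<le> B x"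
    and B: "integrable M B" and F: "\<And>t. integrable M (F t)"
    and F'[measurable]: "\<And>t. F' t \<in> borel_measurable M"
  shows "((\<lambda>t. \<integral>x. F t x \<partial>M) has_real_derivative (\<integral>x. F' t x \<partial>M)) (at t)"
  unfolding has_field_derivative_iff
proof (subst tendsto_at_iff_sequentially, intro allI impI)
  have [measurable]: "F t \<in> borel_measurable M" for t
    using F by auto
  fix X :: "nat \<Rightarrow> real" assume X: "\<forall>i. X i \<in> UNIV - {t}" "X \<longlonglongrightarrow> t"
  have "(\<lambda>i. \<integral>x. (F (X i) x - F t x) / (X i - t) \<partial>M) \<longlonglongrightarrow> (\<integral>x. F' t x \<partial>M)"
  proof (rule integral_dominated_convergence[where w = B])
    show "AE x in M. (\<lambda>i. (F (X i) x - F t x) / (X i - t)) \<longlonglongrightarrow> F' t x"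
    proof (rule AE_I2)
      fix x assume "x \<in> space M"
      from deriv[OF this, of t] show "(\<lambda>i. (F (X i) x - F t x) / (X i - t)) \<longlonglongrightarrow> F' t x"
        unfolding has_field_derivative_iff tendsto_at_iff_sequentially o_def using X by blast
    qed
    show "AE x in M. norm ((F (X i) x - F t x) / (X i - t)) \<le> B x" for i
    proof (rule AE_I2)
      fix x assume x: "x \<in> space M"
      have "\<bar>F (X i) x - F t x\<bar> \<le> B x * \<bar>X i - t\<bar>"
        using field_differentiable_bound[of UNIV "\<lambda>t. F t x" "\<lambda>t. F' t x" "B x" t "X i"]
          deriv[OF x] bound[OF x] by (simp add: abs_minus_commute)
      moreover have "\<bar>X i - t\<bar> > 0" using X by simp
      ultimately show "norm ((F (X i) x - F t x) / (X i - t)) \<le> B x"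
        by (simp add: divide_le_eq)
    qed
  qed (use B in auto)
  then show "((\<lambda>s. ((\<integral>x. F s x \<partial>M) - (\<integral>x. F t x \<partial>M)) / (s - t)) \<circ> X) \<longlonglongrightarrow> (\<integral>x. F' t x \<partial>M)"
    using F by (simp add: o_def)
qed

lemma integrable_gauss_PiM_exp_abs:
  assumes "finite I"
  shows "integrable (PiM I (\<lambda>_. gauss)) (\<lambda>x. exp (K * (\<Sum>i\<in>I. \<bar>x i\<bar>)))"
proof -
  have "integrable (PiM I (\<lambda>_. gauss)) (\<lambda>x. \<Prod>i\<in>I. exp (K * \<bar>x i\<bar>))"
    using assms gauss_integrable_exp_abs by (intro gauss_product.product_integrable_prod)
  then show ?thesis
    using assms by (simp add: exp_sum sum_distrib_left)
qed

lemma integrable_gauss_PiM_exp_bounded: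
  fixes f :: "('i \<Rightarrow> real) \<Rightarrow> real"
  assumes "finite I" "f \<in> borel_measurable (PiM I (\<lambda>_. gauss))"
    and "\<And>x. \<bar>f x\<bar> \<le> C * exp (K * (\<Sum>i\<in>I. \<bar>x i\<bar>))"
  shows "integrable (PiM I (\<lambda>_. gauss)) f"
proof (rule Bochner_Integration.integrable_bound)
  show "integrable (PiM I (\<lambda>_. gauss)) (\<lambda>x. C * exp (K * (\<Sum>i\<in>I. \<bar>x i\<bar>)))"
    using integrable_gauss_PiM_exp_abs[OF assms(1)] by simp
  show "AE x in PiM I (\<lambda>_. gauss). norm (f x) \<le> norm (C * exp (K * (\<Sum>i\<in>I. \<bar>x i\<bar>)))"
    using assms(3) by (auto intro!: AE_I2 order_trans[OF _ abs_ge_self])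
qed (use assms in simp)

text \<open>Fubini with coordinate \<open>i\<close> innermost reduces this to one dimension: the
  other coordinates are frozen, and their share of the exponential bound becomes part of the
  constant.\<close>

lemma gauss_PiM_by_parts:
  fixes f f' :: "('i \<Rightarrow> real) \<Rightarrow> real"
  assumes fin: "finite I" and i: "i \<in> I"
    and deriv: "\<And>x t. ((\<lambda>t. f (x(i := t))) has_real_derivative f' (x(i := t))) (at t)"
    and cont: "\<And>x t. isCont (\<lambda>t. f' (x(i := t))) t"
    and [measurable]: "f \<in> borel_measurable (PiM I (\<lambda>_. gauss))" "f' \<in> borel_measurable (PiM I (\<lambda>_. gauss))"
    and f_bound: "\<And>x. \<bar>f x\<bar> \<le> C * exp (K * (\<Sum>i\<in>I. \<bar>x i\<bar>))"
    and f'_bound: "\<And>x. \<bar>f' x\<bar> \<le> C * exp (K * (\<Sum>i\<in>I. \<bar>x i\<bar>))"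
    and K: "0 \<le> K"
  shows "has_bochner_integral (PiM I (\<lambda>_. gauss)) (\<lambda>x. x i * f x) (\<integral>x. f' x \<partial>PiM I (\<lambda>_. gauss))"
proof -
  have C: "0 \<le> C"
    using order_trans[OF abs_ge_zero f_bound[of "\<lambda>_. 0"]] by simp
  have bound: "\<bar>x i * f x\<bar> \<le> C * exp ((K + 1) * (\<Sum>i\<in>I. \<bar>x i\<bar>))" for x
  proof -
    have "\<bar>x i\<bar> \<le> (\<Sum>i\<in>I. \<bar>x i\<bar>)"
      using fin i by (intro member_le_sum) auto
    then have "\<bar>x i\<bar> * \<bar>f x\<bar> \<le> (\<Sum>i\<in>I. \<bar>x i\<bar>) * \<bar>f x\<bar>"
      by (intro mult_right_mono) auto
    also have "\<dots> = \<bar>(\<Sum>i\<in>I. \<bar>x i\<bar>) * f x\<bar>"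
      by (simp add: abs_mult sum_nonneg)
    also have "\<dots> \<le> C * exp ((K + 1) * \<bar>\<Sum>i\<in>I. \<bar>x i\<bar>\<bar>)"
      using f_bound[of x] by (intro exp_bounded_mult_id) (simp add: sum_nonneg)
    finally show ?thesis by (simp add: abs_mult sum_nonneg)
  qed
  have int: "integrable (PiM I (\<lambda>_. gauss)) (\<lambda>x. x i * f x)"
    using fin i by (intro integrable_gauss_PiM_exp_bounded[OF _ _ bound]) measurable
  have int': "integrable (PiM I (\<lambda>_. gauss)) f'"
    using fin by (intro integrable_gauss_PiM_exp_bounded[OF _ _ f'_bound]) measurable
  have I: "insert i (I - {i}) = I" using i by blast
  have sum_upd: "(\<Sum>j\<in>I. \<bar>(x(i := t)) j\<bar>) = \<bar>t\<bar> + (\<Sum>j\<in>I - {i}. \<bar>x j\<bar>)" for x t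
    using fin i by (simp add: sum.remove)
  have one: "(\<integral>t. t * f (x(i := t)) \<partial>gauss) = (\<integral>t. f' (x(i := t)) \<partial>gauss)" for x
  proof (rule gauss_by_parts)
    have e: "C * exp (K * (\<Sum>j\<in>I. \<bar>(x(i := t)) j\<bar>)) = (C * exp (K * (\<Sum>j\<in>I - {i}. \<bar>x j\<bar>))) * exp (K * \<bar>t\<bar>)" for t
      unfolding sum_upd by (simp add: distrib_left exp_add)
    show "\<bar>f (x(i := t))\<bar> \<le> (C * exp (K * (\<Sum>j\<in>I - {i}. \<bar>x j\<bar>))) * exp (K * \<bar>t\<bar>)"
      and "\<bar>f' (x(i := t))\<bar> \<le> (C * exp (K * (\<Sum>j\<in>I - {i}. \<bar>x j\<bar>))) * exp (K * \<bar>t\<bar>)" for t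
      using f_bound[of "x(i := t)"] f'_bound[of "x(i := t)"] unfolding e by auto
  qed (fact deriv cont)+
  have "(\<integral>x. x i * f x \<partial>PiM I (\<lambda>_. gauss)) = (\<integral>x. f' x \<partial>PiM I (\<lambda>_. gauss))"
    using gauss_product.product_integral_insert[of "I - {i}" i "\<lambda>x. x i * f x"]
      gauss_product.product_integral_insert[of "I - {i}" i f'] fin int int'
    unfolding I by (simp add: one)
  with int show ?thesis
    by (simp add: has_bochner_integral_iff)
qed

text \<open>Differentiating along the path and integrating by parts turns the derivative of the
  expectation into the expectation of \<open>sin \<theta> * cos \<theta>\<close> times the signed sum of the second
  derivatives.\<close>

lemma gauss_interpolation:
  fixes H :: "('i \<Rightarrow> real) \<Rightarrow> real" and D D2 :: "'i \<Rightarrow> ('i \<Rightarrow> real) \<Rightarrow> real"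
  assumes fin: "finite I" and JI: "J \<subseteq> I"
    and H_deriv: "\<And>x x' t. (\<And>i. i \<in> I \<Longrightarrow> ((\<lambda>t. x t i) has_real_derivative x' i) (at t)) \<Longrightarrow>
      ((\<lambda>t. H (x t)) has_real_derivative (\<Sum>i\<in>I. x' i * D i (x t))) (at t)"
    and D_deriv: "\<And>i x t. i \<in> I \<Longrightarrow> ((\<lambda>t. D i (x(i := t))) has_real_derivative D2 i (x(i := t))) (at t)"
    and D2_cont: "\<And>i x t. i \<in> I \<Longrightarrow> isCont (\<lambda>t. D2 i (x(i := t))) t"
    and H_meas: "\<And>a. (\<lambda>x. H (\<lambda>i. a i * x i)) \<in> borel_measurable (PiM I (\<lambda>_. gauss))"
    and D_meas: "\<And>a i. i \<in> I \<Longrightarrow> (\<lambda>x. D i (\<lambda>i. a i * x i)) \<in> borel_measurable (PiM I (\<lambda>_. gauss))"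
    and D2_meas: "\<And>a i. i \<in> I \<Longrightarrow> (\<lambda>x. D2 i (\<lambda>i. a i * x i)) \<in> borel_measurable (PiM I (\<lambda>_. gauss))"
    and K: "0 \<le> K"
    and H_bound: "\<And>x. \<bar>H x\<bar> \<le> C * exp (K * (\<Sum>i\<in>I. \<bar>x i\<bar>))"
    and D_bound: "\<And>i x. i \<in> I \<Longrightarrow> \<bar>D i x\<bar> \<le> C * exp (K * (\<Sum>i\<in>I. \<bar>x i\<bar>))"
    and D2_bound: "\<And>i x. i \<in> I \<Longrightarrow> \<bar>D2 i x\<bar> \<le> C * exp (K * (\<Sum>i\<in>I. \<bar>x i\<bar>))"
    and sign: "\<And>x. (\<Sum>i\<in>J. D2 i x) \<le> (\<Sum>i\<in>I - J. D2 i x)"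
  shows "(\<integral>x. H (\<lambda>i. (if i \<in> J then 1 else 0) * x i) \<partial>PiM I (\<lambda>_. gauss))
       \<le> (\<integral>x. H (\<lambda>i. (if i \<in> J then 0 else 1) * x i) \<partial>PiM I (\<lambda>_. gauss))"
proof -
  let ?P = "PiM I (\<lambda>_. gauss)"
  \<comment> \<open>At \<open>\<theta> = 0\<close> only the coordinates in \<open>J\<close> survive,
    at \<open>pi / 2\<close> only the others; \<open>a'\<close> is the derivative of
    \<open>a\<close> in \<open>\<theta>\<close>.\<close>
  define a where "a \<theta> i = (if i \<in> J then cos \<theta> else sin \<theta>)" for \<theta> :: real and i
  define a' where "a' \<theta> i = (if i \<in> J then - sin \<theta> else cos \<theta>)" for \<theta> :: real and i
  have a_le: "\<bar>a \<theta> i\<bar> \<le> 1" "\<bar>a' \<theta> i\<bar> \<le> 1" for \<theta> i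
    by (auto simp: a_def a'_def)
  have C: "0 \<le> C"
    using order_trans[OF abs_ge_zero H_bound[of "\<lambda>_. 0"]] by simp
  \<comment> \<open>The coefficients have modulus at most one, so a single majorant serves all
    \<open>\<theta>\<close>, as differentiation under the integral requires.\<close>
  have scale: "C * exp (K * (\<Sum>i\<in>I. \<bar>a \<theta> i * x i\<bar>)) \<le> C * exp (K * (\<Sum>i\<in>I. \<bar>x i\<bar>))" for \<theta> x
  proof -
    have "(\<Sum>i\<in>I. \<bar>a \<theta> i * x i\<bar>) \<le> (\<Sum>i\<in>I. \<bar>x i\<bar>)"
      using mult_right_mono[OF a_le(1)] by (intro sum_mono) (simp add: abs_mult)
    then show ?thesis
      using C K by (intro mult_left_mono) (auto intro!: mult_left_mono)
  qed
  have parts: "has_bochner_integral ?P (\<lambda>x. x i * D i (\<lambda>i. a \<theta> i * x i))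
      (\<integral>x. a \<theta> i * D2 i (\<lambda>i. a \<theta> i * x i) \<partial>?P)"
    if i: "i \<in> I" for i \<theta>
  proof (rule gauss_PiM_by_parts[OF fin i])
    fix x t
    have upd: "(\<lambda>j. a \<theta> j * (x(i := t)) j) = (\<lambda>j. a \<theta> j * x j)(i := a \<theta> i * t)" for t
      by (auto simp: fun_eq_iff)
    show "((\<lambda>t. D i (\<lambda>j. a \<theta> j * (x(i := t)) j)) has_real_derivative
        a \<theta> i * D2 i (\<lambda>j. a \<theta> j * (x(i := t)) j)) (at t)"
      unfolding upd by (rule DERIV_cong[OF DERIV_chain2[OF D_deriv[OF i]]]) (auto intro!: derivative_eq_intros)
    have "isCont (\<lambda>t. D2 i ((\<lambda>j. a \<theta> j * x j)(i := a \<theta> i * t))) t"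
      by (rule isCont_o2[where g = "\<lambda>t. D2 i ((\<lambda>j. a \<theta> j * x j)(i := t))" and f = "\<lambda>t. a \<theta> i * t"])
        (auto intro!: D2_cont i)
    then show "isCont (\<lambda>t. a \<theta> i * D2 i (\<lambda>j. a \<theta> j * (x(i := t)) j)) t"
      unfolding upd by (intro continuous_intros)
    show "\<bar>D i (\<lambda>i. a \<theta> i * x i)\<bar> \<le> C * exp (K * (\<Sum>i\<in>I. \<bar>x i\<bar>))"
      by (rule order_trans[OF D_bound[OF i] scale])
    have "\<bar>a \<theta> i\<bar> * \<bar>D2 i (\<lambda>i. a \<theta> i * x i)\<bar> \<le> 1 * (C * exp (K * (\<Sum>i\<in>I. \<bar>x i\<bar>)))"
      by (intro mult_mono a_le order_trans[OF D2_bound[OF i] scale]) auto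
    then show "\<bar>a \<theta> i * D2 i (\<lambda>i. a \<theta> i * x i)\<bar> \<le> C * exp (K * (\<Sum>i\<in>I. \<bar>x i\<bar>))"
      by (simp add: abs_mult)
  qed (use i K D_meas D2_meas in auto)
  have int_D2: "integrable ?P (\<lambda>x. D2 i (\<lambda>i. a \<theta> i * x i))" if i: "i \<in> I" for i \<theta>
    by (intro integrable_gauss_PiM_exp_bounded[OF fin D2_meas[OF i] order_trans[OF D2_bound[OF i] scale]])
  define \<phi> where "\<phi> \<theta> = (\<integral>x. H (\<lambda>i. a \<theta> i * x i) \<partial>?P)" for \<theta>
  define \<phi>' where "\<phi>' \<theta> = (\<integral>x. (\<Sum>i\<in>I. (a' \<theta> i * x i) * D i (\<lambda>i. a \<theta> i * x i)) \<partial>?P)" for \<theta>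
  have \<phi>_deriv: "(\<phi> has_real_derivative \<phi>' \<theta>) (at \<theta>)" for \<theta>
    unfolding \<phi>_def \<phi>'_def
  proof (rule has_real_derivative_integral)
    fix \<theta> x
    show "((\<lambda>\<theta>. H (\<lambda>i. a \<theta> i * x i)) has_real_derivative
        (\<Sum>i\<in>I. (a' \<theta> i * x i) * D i (\<lambda>i. a \<theta> i * x i))) (at \<theta>)"
      by (rule H_deriv) (auto simp: a_def a'_def intro!: derivative_eq_intros)
    have "\<bar>(a' \<theta> i * x i) * D i (\<lambda>i. a \<theta> i * x i)\<bar> \<le> C * exp ((K + 1) * (\<Sum>i\<in>I. \<bar>x i\<bar>))"
      if i: "i \<in> I" for i
    proof -
      have "\<bar>a' \<theta> i\<bar> * \<bar>x i\<bar> \<le> 1 * (\<Sum>i\<in>I. \<bar>x i\<bar>)"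
        using fin i by (intro mult_mono a_le member_le_sum) auto
      then have "\<bar>(a' \<theta> i * x i) * D i (\<lambda>i. a \<theta> i * x i)\<bar> \<le> \<bar>(\<Sum>i\<in>I. \<bar>x i\<bar>) * D i (\<lambda>i. a \<theta> i * x i)\<bar>"
        unfolding abs_mult by (intro mult_right_mono) (auto simp: sum_nonneg)
      also have "\<dots> \<le> C * exp ((K + 1) * \<bar>\<Sum>i\<in>I. \<bar>x i\<bar>\<bar>)"
        using order_trans[OF D_bound[OF i] scale]
        by (intro exp_bounded_mult_id) (simp add: sum_nonneg)
      finally show ?thesis by (simp add: sum_nonneg)
    qed
    then show "\<bar>\<Sum>i\<in>I. (a' \<theta> i * x i) * D i (\<lambda>i. a \<theta> i * x i)\<bar>
        \<le> (\<Sum>i\<in>I. C * exp ((K + 1) * (\<Sum>i\<in>I. \<bar>x i\<bar>)))"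
      by (intro order_trans[OF sum_abs sum_mono])
    show "integrable ?P (\<lambda>x. (\<Sum>i\<in>I. C * exp ((K + 1) * (\<Sum>i\<in>I. \<bar>x i\<bar>))))"
      using integrable_gauss_PiM_exp_abs[OF fin] by simp
    show "integrable ?P (\<lambda>x. H (\<lambda>i. a \<theta> i * x i))"
      by (rule integrable_gauss_PiM_exp_bounded[OF fin H_meas order_trans[OF H_bound scale]])
    note [measurable] = D_meas
    show "(\<lambda>x. \<Sum>i\<in>I. (a' \<theta> i * x i) * D i (\<lambda>i. a \<theta> i * x i)) \<in> borel_measurable ?P"
      by measurable
  qed
  have \<phi>'_eq: "\<phi>' \<theta> = sin \<theta> * cos \<theta> * (\<integral>x. (\<Sum>i\<in>I - J. D2 i (\<lambda>i. a \<theta> i * x i)) - (\<Sum>i\<in>J. D2 i (\<lambda>i. a \<theta> i * x i)) \<partial>?P)" for \<theta>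
  proof -
    have "\<phi>' \<theta> = (\<Sum>i\<in>I. a' \<theta> i * (\<integral>x. x i * D i (\<lambda>i. a \<theta> i * x i) \<partial>?P))"
      unfolding \<phi>'_def using parts[THEN integrable.intros]
      by (subst Bochner_Integration.integral_sum) (auto simp: mult.assoc)
    also have "\<dots> = (\<Sum>i\<in>I. a' \<theta> i * a \<theta> i * (\<integral>x. D2 i (\<lambda>i. a \<theta> i * x i) \<partial>?P))"
      by (intro sum.cong) (auto simp: has_bochner_integral_integral_eq[OF parts])
    also have "\<dots> = (\<Sum>i\<in>J. - (sin \<theta> * cos \<theta>) * (\<integral>x. D2 i (\<lambda>i. a \<theta> i * x i) \<partial>?P))
        + (\<Sum>i\<in>I - J. sin \<theta> * cos \<theta> * (\<integral>x. D2 i (\<lambda>i. a \<theta> i * x i) \<partial>?P))"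
      unfolding sum.subset_diff[OF JI fin] by (simp add: a_def a'_def mult.commute)
    also have "\<dots> = sin \<theta> * cos \<theta> * (\<integral>x. (\<Sum>i\<in>I - J. D2 i (\<lambda>i. a \<theta> i * x i)) - (\<Sum>i\<in>J. D2 i (\<lambda>i. a \<theta> i * x i)) \<partial>?P)"
    proof -
      have int: "integrable ?P (\<lambda>x. \<Sum>i\<in>A. D2 i (\<lambda>i. a \<theta> i * x i))"
        and eq: "(\<integral>x. (\<Sum>i\<in>A. D2 i (\<lambda>i. a \<theta> i * x i)) \<partial>?P) = (\<Sum>i\<in>A. \<integral>x. D2 i (\<lambda>i. a \<theta> i * x i) \<partial>?P)"
        if "A \<subseteq> I" for A
        using that int_D2 by (auto intro!: Bochner_Integration.integral_sum Bochner_Integration.integrable_sum)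
      show ?thesis
        using JI by (simp add: int eq sum_negf right_diff_distrib flip: sum_distrib_left)
    qed
    finally show ?thesis .
  qed
  have "\<phi> 0 \<le> \<phi> (pi / 2)"
  proof (rule DERIV_nonneg_imp_nondecreasing[where f = \<phi>])
    fix \<theta> assume "0 \<le> \<theta>" "\<theta> \<le> pi / 2"
    then have "0 \<le> sin \<theta> * cos \<theta>"
      by (intro mult_nonneg_nonneg sin_ge_zero cos_ge_zero) auto
    moreover have "0 \<le> (\<integral>x. (\<Sum>i\<in>I - J. D2 i (\<lambda>i. a \<theta> i * x i)) - (\<Sum>i\<in>J. D2 i (\<lambda>i. a \<theta> i * x i)) \<partial>?P)"
      using sign by (intro integral_nonneg_AE AE_I2) simp
    ultimately show "\<exists>y. (\<phi> has_real_derivative y) (at \<theta>) \<and> 0 \<le> y"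
      using \<phi>_deriv \<phi>'_eq by (intro exI[of _ "\<phi>' \<theta>"]) simp
  qed simp
  then show ?thesis
    by (simp add: \<phi>_def a_def cong: if_cong)
qed

section \<open>Gordon's comparison\<close>

text \<open>With \<open>l * r = c\<close>, the function \<open>H\<close> below is a smooth stand-in
  for \<open>exp (- c * f)\<close>, where f is the minimum over \<open>W\<close> of the norm of the
  first m linear forms plus the last form. The parameter \<open>\<delta>\<close> makes the norm
  differentiable at the origin, and \<open>r \<le> 1\<close> makes the outer power concave.\<close>

locale softmin_process =
  fixes m n :: nat and W :: "(nat \<Rightarrow> real) set" and \<delta> r l :: real
  assumes finite_W: "finite W" and W_nonempty: "W \<noteq> {}"
    and \<delta>_pos: "0 < \<delta>" and r_pos: "0 < r" and r_le: "r \<le> 1" and l_pos: "0 < l"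
    and last_coord: "\<And>w. w \<in> W \<Longrightarrow> w n = 1"
    and unit: "\<And>w. w \<in> W \<Longrightarrow> (\<Sum>j<n. (w j)\<^sup>2) = 1"
begin

text \<open>All Gaussians are packed into one array with index set \<open>I\<close>: the entries \<open>(i, j)\<close>, \<open>i < m\<close>,
  \<open>j < n\<close>, are the matrix, the last column \<open>(i, n)\<close> is the vector \<open>g\<close>, the last row
  \<open>(m, j)\<close> is the vector \<open>h\<close>, and the corner \<open>(m, n)\<close> is the extra scalar in Gordon's
  process. With \<open>w n = 1\<close> both processes are then given by the same linear forms \<open>lin\<close>.\<close>

definition I :: "(nat \<times> nat) set" where "I = {..m} \<times> {..n}"

definition lin :: "(nat \<Rightarrow> real) \<Rightarrow> (nat \<times> nat \<Rightarrow> real) \<Rightarrow> nat \<Rightarrow> real" where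
  "lin w x i = (\<Sum>j\<le>n. x (i, j) * w j)"

definition nrm :: "(nat \<Rightarrow> real) \<Rightarrow> (nat \<times> nat \<Rightarrow> real) \<Rightarrow> real" where
  "nrm w x = sqrt (\<delta>\<^sup>2 + (\<Sum>i<m. (lin w x i)\<^sup>2))"

definition p :: "(nat \<Rightarrow> real) \<Rightarrow> (nat \<times> nat \<Rightarrow> real) \<Rightarrow> real" where
  "p w x = exp (- l * (nrm w x + lin w x m))"

definition S :: "(nat \<times> nat \<Rightarrow> real) \<Rightarrow> real" where
  "S x = (\<Sum>w\<in>W. p w x)"

definition H :: "(nat \<times> nat \<Rightarrow> real) \<Rightarrow> real" where
  "H x = S x powr r"

text \<open>\<open>y\<close> and \<open>y2\<close> are the first and pure second partial derivatives of
  \<open>sqrt (\<delta>\<^sup>2 + v\<^sub>0\<^sup>2 + \<dots> + v\<^sub>m\<^sub>-\<^sub>1\<^sup>2) + v\<^sub>m\<close> in \<open>v\<^sub>i\<close>, and \<open>D\<close> and \<open>D2\<close> those of \<open>H\<close>.\<close>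

definition y :: "(nat \<Rightarrow> real) \<Rightarrow> (nat \<times> nat \<Rightarrow> real) \<Rightarrow> nat \<Rightarrow> real" where
  "y w x i = (if i < m then lin w x i / nrm w x else 1)"

definition y2 :: "(nat \<Rightarrow> real) \<Rightarrow> (nat \<times> nat \<Rightarrow> real) \<Rightarrow> nat \<Rightarrow> real" where
  "y2 w x i = (if i < m then (1 - (lin w x i / nrm w x)\<^sup>2) / nrm w x else 0)"

definition D :: "nat \<times> nat \<Rightarrow> (nat \<times> nat \<Rightarrow> real) \<Rightarrow> real" where
  "D k x = - (l * r) * S x powr (r - 1) * (\<Sum>w\<in>W. p w x * (y w x (fst k) * w (snd k)))"

definition D2 :: "nat \<times> nat \<Rightarrow> (nat \<times> nat \<Rightarrow> real) \<Rightarrow> real" where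
  "D2 k x = r * (r - 1) * l\<^sup>2 * S x powr (r - 2) * (\<Sum>w\<in>W. p w x * (y w x (fst k) * w (snd k)))\<^sup>2
    + r * S x powr (r - 1) * (\<Sum>w\<in>W. p w x *
        (l\<^sup>2 * ((y w x (fst k))\<^sup>2 * (w (snd k))\<^sup>2) - l * (y2 w x (fst k) * (w (snd k))\<^sup>2)))"

lemma finite_I: "finite I"
  by (simp add: I_def)

lemma sum_I: "(\<Sum>k\<in>I. f k) = (\<Sum>i\<le>m. \<Sum>j\<le>n. f (i, j))"
  by (simp add: I_def sum.cartesian_product)

lemma nrm_pos: "0 < nrm w x"
  using \<delta>_pos by (auto simp: nrm_def intro!: add_pos_nonneg sum_nonneg)

lemma nrm_square: "(nrm w x)\<^sup>2 = \<delta>\<^sup>2 + (\<Sum>i<m. (lin w x i)\<^sup>2)"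
  by (simp add: nrm_def sum_nonneg)

lemma nrm_ge: "\<delta> \<le> nrm w x"
  using \<delta>_pos by (auto simp: nrm_def intro!: real_le_rsqrt sum_nonneg)

lemma p_pos: "0 < p w x"
  by (simp add: p_def)

lemma S_pos: "0 < S x"
  using finite_W W_nonempty p_pos by (auto simp: S_def intro: sum_pos)

text \<open>The \<open>y w x i\<close> with \<open>i < m\<close> form the gradient of the smoothed
  norm. Smoothing makes it shorter than a unit vector, and only the upper bound enters the sign
  argument.\<close>

lemma sum_y_square: "(\<Sum>i<m. (y w x i)\<^sup>2) \<le> 1"
proof -
  have "(\<Sum>i<m. (y w x i)\<^sup>2) = (\<Sum>i<m. (lin w x i)\<^sup>2) / (nrm w x)\<^sup>2"
    by (simp add: y_def power_divide sum_divide_distrib)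
  also have "(\<Sum>i<m. (lin w x i)\<^sup>2) \<le> (nrm w x)\<^sup>2"
    unfolding nrm_square by simp
  then have "(\<Sum>i<m. (lin w x i)\<^sup>2) / (nrm w x)\<^sup>2 \<le> 1"
    using nrm_pos[of w x] by (subst divide_le_eq_1_pos) auto
  finally show ?thesis .
qed

lemma y_le: "\<bar>y w x i\<bar> \<le> 1"
proof (cases "i < m")
  case True
  then have "(y w x i)\<^sup>2 \<le> (\<Sum>i<m. (y w x i)\<^sup>2)"
    by (intro member_le_sum) auto
  with sum_y_square[of w x] have "(y w x i)\<^sup>2 \<le> 1"
    by linarith
  then show ?thesis
    by (simp add: abs_square_le_1)
qed (simp add: y_def)

text \<open>Smoothing caps the curvature of the norm at \<open>1 / \<delta>\<close>; the unsmoothed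
  second derivative is unbounded near the origin.\<close>

lemma y2_bounds: "0 \<le> y2 w x i" "y2 w x i \<le> 1 / \<delta>"
proof -
  have "(y w x i)\<^sup>2 \<le> 1"
    using y_le[of w x i] by (simp add: abs_square_le_1)
  then show "0 \<le> y2 w x i"
    using nrm_pos[of w x] by (auto simp: y2_def y_def split: if_splits)
  show "y2 w x i \<le> 1 / \<delta>"
    using nrm_ge[of w x] \<delta>_pos by (auto simp: y2_def intro!: frac_le)
qed

lemma w_le: "w \<in> W \<Longrightarrow> j \<le> n \<Longrightarrow> \<bar>w j\<bar> \<le> 1"
proof (cases "j = n")
  case False
  assume "w \<in> W" "j \<le> n"
  with False have "(w j)\<^sup>2 \<le> (\<Sum>j<n. (w j)\<^sup>2)"
    by (intro member_le_sum) auto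
  with unit[OF \<open>w \<in> W\<close>] show ?thesis
    by (simp add: abs_square_le_1)
qed (simp add: last_coord)

section \<open>Derivatives along an arbitrary differentiable path\<close>

context
  fixes x :: "real \<Rightarrow> nat \<times> nat \<Rightarrow> real" and x' :: "nat \<times> nat \<Rightarrow> real" and t :: real
  assumes path: "\<And>k. k \<in> I \<Longrightarrow> ((\<lambda>t. x t k) has_real_derivative x' k) (at t)"
begin

lemma lin_deriv: "i \<le> m \<Longrightarrow> ((\<lambda>t. lin w (x t) i) has_real_derivative lin w x' i) (at t)"
  unfolding lin_def using path by (auto intro!: DERIV_sum DERIV_cmult_right simp: I_def)

lemma nrm_deriv:
  "((\<lambda>t. nrm w (x t)) has_real_derivative (\<Sum>i<m. y w (x t) i * lin w x' i)) (at t)"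
proof -
  have sq: "((\<lambda>t. (lin w (x t) i)\<^sup>2) has_real_derivative 2 * lin w (x t) i * lin w x' i) (at t)" if "i < m" for i
    by (rule DERIV_cong[OF DERIV_power[OF lin_deriv]]) (use that in auto)
  have "((\<lambda>t. \<delta>\<^sup>2 + (\<Sum>i<m. (lin w (x t) i)\<^sup>2)) has_real_derivative
      (\<Sum>i<m. 2 * lin w (x t) i * lin w x' i)) (at t)"
    by (rule DERIV_cong[OF DERIV_add[OF DERIV_const DERIV_sum[OF sq]]]) auto
  moreover have "0 < \<delta>\<^sup>2 + (\<Sum>i<m. (lin w (x t) i)\<^sup>2)"
    using nrm_pos[of w "x t"] by (simp flip: nrm_square)
  ultimately have "((\<lambda>t. nrm w (x t)) has_real_derivative
      inverse (nrm w (x t)) / 2 * (\<Sum>i<m. 2 * lin w (x t) i * lin w x' i)) (at t)"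
    unfolding nrm_def by (rule DERIV_chain2[OF DERIV_real_sqrt, rotated])
  also have "inverse (nrm w (x t)) / 2 * (\<Sum>i<m. 2 * lin w (x t) i * lin w x' i)
      = (\<Sum>i<m. y w (x t) i * lin w x' i)"
    unfolding sum_distrib_left by (rule sum.cong) (auto simp: y_def field_simps)
  finally show ?thesis .
qed

lemma p_deriv:
  "((\<lambda>t. p w (x t)) has_real_derivative - l * (p w (x t) * (\<Sum>i\<le>m. y w (x t) i * lin w x' i))) (at t)"
proof -
  have "{..m} = insert m {..<m}" by auto
  then have "(\<Sum>i\<le>m. y w (x t) i * lin w x' i) = (\<Sum>i<m. y w (x t) i * lin w x' i) + lin w x' m"
    by (simp add: y_def)
  then show ?thesis
    unfolding p_def
    by (auto intro!: derivative_eq_intros nrm_deriv lin_deriv simp: algebra_simps)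
qed

lemma S_deriv:
  "((\<lambda>t. S (x t)) has_real_derivative
    - l * (\<Sum>w\<in>W. p w (x t) * (\<Sum>i\<le>m. y w (x t) i * lin w x' i))) (at t)"
  unfolding S_def sum_distrib_left[of _ _ W] by (intro DERIV_sum p_deriv)

lemma S_powr_deriv:
  "((\<lambda>t. S (x t) powr a) has_real_derivative
    - (l * a) * S (x t) powr (a - 1) * (\<Sum>w\<in>W. p w (x t) * (\<Sum>i\<le>m. y w (x t) i * lin w x' i))) (at t)"
  by (rule DERIV_cong[OF DERIV_fun_powr[OF S_deriv]]) (auto simp: S_pos)

text \<open>Exchanging the sum over \<open>W\<close> with the sums over the array collects the
  coefficient \<open>D k\<close> of each velocity \<open>x' k\<close>, the form that the
  interpolation expects.\<close>

lemma H_deriv: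
  "((\<lambda>t. H (x t)) has_real_derivative (\<Sum>k\<in>I. x' k * D k (x t))) (at t)"
proof -
  have "(\<Sum>w\<in>W. p w (x t) * (\<Sum>i\<le>m. y w (x t) i * lin w x' i))
      = (\<Sum>k\<in>I. x' k * (\<Sum>w\<in>W. p w (x t) * (y w (x t) (fst k) * w (snd k))))"
    unfolding sum_I lin_def sum_distrib_left fst_conv snd_conv
    by (subst sum.swap, intro sum.cong refl, subst sum.swap, intro sum.cong refl) (simp add: mult_ac)
  then show ?thesis
    using S_powr_deriv[of r] by (simp add: H_def D_def sum_distrib_left mult_ac)
qed

end

section \<open>Second derivatives along coordinate lines\<close>

context
  fixes i j :: nat and x :: "nat \<times> nat \<Rightarrow> real"
  assumes ij: "(i, j) \<in> I"
begin

abbreviation (input) line :: "real \<Rightarrow> nat \<times> nat \<Rightarrow> real" where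
  "line t \<equiv> x((i, j) := t)"

abbreviation (input) e :: "nat \<times> nat \<Rightarrow> real" where
  "e k \<equiv> if k = (i, j) then 1 else 0"

lemma line_deriv: "((\<lambda>t. line t k) has_real_derivative e k) (at t)"
  by (auto intro!: derivative_eq_intros)

lemma lin_e: "lin w e a = (if a = i then w j else 0)"
  using ij by (simp add: lin_def I_def if_distrib[of "\<lambda>z. z * _"] cong: if_cong)

lemma sum_lin_e: "(\<Sum>a\<le>m. y w z a * lin w e a) = y w z i * w j"
  using ij by (simp add: lin_e I_def if_distrib[of "\<lambda>z. _ * z"] cong: if_cong)

lemmas lin_line_deriv = lin_deriv[where x = line and x' = e, OF line_deriv, unfolded lin_e]
lemmas p_line_deriv = p_deriv[where x = line and x' = e, OF line_deriv, unfolded sum_lin_e]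
lemmas S_powr_line_deriv = S_powr_deriv[where x = line and x' = e, OF line_deriv, unfolded sum_lin_e]

lemma nrm_line_deriv:
  "((\<lambda>t. nrm w (line t)) has_real_derivative (if i < m then y w (line t) i * w j else 0)) (at t)"
  using nrm_deriv[where x = line and x' = e, OF line_deriv, of w t]
  by (simp add: lin_e if_distrib[of "\<lambda>z. _ * z"] cong: if_cong)

lemma y_line_deriv: "((\<lambda>t. y w (line t) i) has_real_derivative y2 w (line t) i * w j) (at t)"
proof (cases "i < m")
  case True
  have "((\<lambda>t. lin w (line t) i / nrm w (line t)) has_real_derivative
      (w j * nrm w (line t) - lin w (line t) i * (y w (line t) i * w j)) / (nrm w (line t) * nrm w (line t))) (at t)"
    using True nrm_pos[of w "line t"] nrm_line_deriv[of w t] lin_line_deriv[of i w t]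
    by (auto intro!: DERIV_divide)
  then show ?thesis
    using True nrm_pos[of w "line t"]
    by (simp add: y_def y2_def power2_eq_square field_simps)
qed (simp add: y_def y2_def)

text \<open>The coordinate enters in three places: the power of \<open>S\<close> gives the squared
  sum with \<open>r * (r - 1)\<close>, the weights \<open>p\<close> give the terms with the square
  of \<open>l\<close>, and \<open>y\<close> gives the curvature terms with
  \<open>y2\<close>.\<close>

lemma D_line_deriv: "((\<lambda>t. D (i, j) (line t)) has_real_derivative D2 (i, j) (line t)) (at t)"
proof -
  have 1: "((\<lambda>t. \<Sum>w\<in>W. p w (line t) * (y w (line t) i * w j)) has_real_derivative
      (\<Sum>w\<in>W. - (l * (p w (line t) * ((y w (line t) i)\<^sup>2 * (w j)\<^sup>2))) + p w (line t) * (y2 w (line t) i * (w j)\<^sup>2))) (at t)"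
    by (rule DERIV_cong[OF DERIV_sum[OF DERIV_mult[OF p_line_deriv DERIV_cmult_right[OF y_line_deriv]]]])
      (auto simp: power2_eq_square algebra_simps intro!: sum.cong)
  show ?thesis
    unfolding D_def D2_def fst_conv snd_conv mult.assoc
    by (rule DERIV_cong[OF DERIV_cmult[OF DERIV_mult[OF S_powr_line_deriv 1]]])
      (simp add: power2_eq_square sum_distrib_left sum.distrib sum_negf sum_subtractf algebra_simps)
qed

lemma D2_line_cont: "isCont (\<lambda>t. D2 (i, j) (line t)) t"
proof -
  have [continuous_intros]: "isCont (\<lambda>t. y2 w (line t) i) t" for w
    unfolding y2_def using ij nrm_pos[of w "line t"]
    by (cases "i < m")
      (auto intro!: continuous_intros DERIV_isCont[OF lin_line_deriv] DERIV_isCont[OF nrm_line_deriv])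
  show ?thesis
    unfolding D2_def fst_conv snd_conv
    by (intro continuous_intros DERIV_isCont[OF S_powr_line_deriv] DERIV_isCont[OF p_line_deriv]
        DERIV_isCont[OF y_line_deriv])
qed

end

section \<open>Measurability and growth bounds\<close>

lemma lin_measurable [measurable]:
  "i \<le> m \<Longrightarrow> (\<lambda>x. lin w (\<lambda>k. a k * x k) i) \<in> borel_measurable (PiM I (\<lambda>_. gauss))"
  unfolding lin_def
  by (intro borel_measurable_sum borel_measurable_times borel_measurable_const)
    (auto intro!: measurable_component_singleton simp: I_def cong: measurable_cong_sets)

lemma nrm_measurable [measurable]:
  "(\<lambda>x. nrm w (\<lambda>k. a k * x k)) \<in> borel_measurable (PiM I (\<lambda>_. gauss))"
  unfolding nrm_def
  by (intro borel_measurable_sqrt[THEN measurable_compose_rev] borel_measurable_add borel_measurable_sum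
      borel_measurable_power borel_measurable_const) (auto intro: lin_measurable)

lemma S_measurable [measurable]:
  "(\<lambda>x. S (\<lambda>k. a k * x k)) \<in> borel_measurable (PiM I (\<lambda>_. gauss))"
  unfolding S_def p_def by measurable

lemma p_measurable [measurable]:
  "(\<lambda>x. p w (\<lambda>k. a k * x k)) \<in> borel_measurable (PiM I (\<lambda>_. gauss))"
  unfolding p_def by measurable

lemma H_measurable [measurable]:
  "(\<lambda>x. H (\<lambda>k. a k * x k)) \<in> borel_measurable (PiM I (\<lambda>_. gauss))"
  unfolding H_def by measurable

lemma y_measurable [measurable]:
  "i \<le> m \<Longrightarrow> (\<lambda>x. y w (\<lambda>k. a k * x k) i) \<in> borel_measurable (PiM I (\<lambda>_. gauss))"
  unfolding y_def by measurable

lemma y2_measurable [measurable]: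
  "i \<le> m \<Longrightarrow> (\<lambda>x. y2 w (\<lambda>k. a k * x k) i) \<in> borel_measurable (PiM I (\<lambda>_. gauss))"
  unfolding y2_def by measurable

lemma D_measurable:
  "k \<in> I \<Longrightarrow> (\<lambda>x. D k (\<lambda>k. a k * x k)) \<in> borel_measurable (PiM I (\<lambda>_. gauss))"
proof -
  assume "k \<in> I"
  then have [measurable]: "fst k \<le> m" by (auto simp: I_def)
  show ?thesis
    unfolding D_def by measurable
qed

lemma D2_measurable:
  "k \<in> I \<Longrightarrow> (\<lambda>x. D2 k (\<lambda>k. a k * x k)) \<in> borel_measurable (PiM I (\<lambda>_. gauss))"
proof -
  assume "k \<in> I"
  then have [measurable]: "fst k \<le> m" by (auto simp: I_def)
  show ?thesis
    unfolding D2_def by measurable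
qed

lemma H_bound: "H x \<le> card W * exp (l * (\<Sum>k\<in>I. \<bar>x k\<bar>))"
proof -
  let ?E = "exp (l * (\<Sum>k\<in>I. \<bar>x k\<bar>))"
  have "p w x \<le> ?E" if "w \<in> W" for w
  proof -
    have "- lin w x m \<le> (\<Sum>j\<le>n. \<bar>x (m, j)\<bar>)"
      unfolding lin_def sum_negf[symmetric]
    proof (rule sum_mono)
      fix j assume "j \<in> {..n}"
      then have "\<bar>x (m, j)\<bar> * \<bar>w j\<bar> \<le> \<bar>x (m, j)\<bar> * 1"
        using w_le[OF that] by (intro mult_left_mono) auto
      then show "- (x (m, j) * w j) \<le> \<bar>x (m, j)\<bar>"
        by (simp flip: abs_mult)
    qed
    also have "\<dots> \<le> (\<Sum>k\<in>I. \<bar>x k\<bar>)"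
      unfolding sum_I by (intro member_le_sum) (auto intro: sum_nonneg)
    finally have "l * (- (nrm w x + lin w x m)) \<le> l * (\<Sum>k\<in>I. \<bar>x k\<bar>)"
      using nrm_pos[of w x] l_pos by (intro mult_left_mono) auto
    then show ?thesis
      by (simp add: p_def algebra_simps)
  qed
  then have "S x \<le> card W * ?E"
    unfolding S_def by (rule sum_bounded_above)
  then have "H x \<le> (card W * ?E) powr r"
    using S_pos[of x] r_pos by (simp add: H_def powr_mono2)
  \<comment> \<open>The base is at least one since \<open>W\<close> is nonempty and the exponent in
    \<open>?E\<close> is nonnegative, so raising the power from \<open>r\<close> to 1 only increases
    it.\<close>
  also have "\<dots> \<le> (card W * ?E) powr 1"
  proof (rule powr_mono[OF r_le])
    have "1 * 1 \<le> real (card W) * ?E"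
      using finite_W W_nonempty l_pos
      by (intro mult_mono) (auto simp: Suc_le_eq card_gt_0_iff intro!: sum_nonneg mult_nonneg_nonneg)
    then show "1 \<le> real (card W) * ?E" by simp
  qed
  finally show ?thesis by simp
qed

lemma H_nonneg: "0 \<le> H x"
  by (simp add: H_def)

lemma H_integrable:
  assumes a: "\<And>k. \<bar>a k\<bar> \<le> 1"
  shows "integrable (PiM I (\<lambda>_. gauss)) (\<lambda>x. H (\<lambda>k. a k * x k))"
proof (rule integrable_gauss_PiM_exp_bounded[OF finite_I H_measurable])
  fix x :: "nat \<times> nat \<Rightarrow> real"
  have "(\<Sum>k\<in>I. \<bar>a k * x k\<bar>) \<le> (\<Sum>k\<in>I. \<bar>x k\<bar>)"
    using mult_right_mono[OF a] by (intro sum_mono) (simp add: abs_mult)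
  then have "card W * exp (l * (\<Sum>k\<in>I. \<bar>a k * x k\<bar>)) \<le> card W * exp (l * (\<Sum>k\<in>I. \<bar>x k\<bar>))"
    using l_pos by (intro mult_left_mono) auto
  then show "\<bar>H (\<lambda>k. a k * x k)\<bar> \<le> card W * exp (l * (\<Sum>k\<in>I. \<bar>x k\<bar>))"
    using H_bound[of "\<lambda>k. a k * x k"] H_nonneg by simp
qed

lemma S_powr_mult: "S x powr (r - 1) * S x = H x"
  using S_pos[of x] by (simp add: H_def powr_diff)

lemma S_powr_mult_square: "S x powr (r - 2) * (S x)\<^sup>2 = H x"
  using S_pos[of x] by (simp add: H_def powr_diff powr_numeral)

text \<open>The weights \<open>p w x\<close> add up to \<open>S x\<close>, so each such sum cancels
  one negative power of \<open>S\<close> in \<open>D\<close> and \<open>D2\<close>. Both derivatives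
  are therefore at most a constant times \<open>H\<close> and inherit its growth bound.\<close>

lemma weighted_sum_bound:
  assumes "\<And>w. w \<in> W \<Longrightarrow> \<bar>f w\<bar> \<le> c"
  shows "\<bar>\<Sum>w\<in>W. p w x * f w\<bar> \<le> c * S x"
proof -
  have "\<bar>p w x * f w\<bar> \<le> c * p w x" if "w \<in> W" for w
    using assms[OF that] p_pos[of w x] by (simp add: abs_mult mult.commute)
  then show ?thesis
    unfolding S_def sum_distrib_left by (intro order_trans[OF sum_abs sum_mono])
qed

lemma yw_le: "k \<in> I \<Longrightarrow> w \<in> W \<Longrightarrow> \<bar>y w x (fst k) * w (snd k)\<bar> \<le> 1"
  using mult_mono[OF y_le w_le, of w "snd k" w x "fst k"] by (auto simp: I_def abs_mult)

lemma D_bound: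
  assumes k: "k \<in> I"
  shows "\<bar>D k x\<bar> \<le> l * r * H x"
proof -
  have "\<bar>\<Sum>w\<in>W. p w x * (y w x (fst k) * w (snd k))\<bar> \<le> 1 * S x"
    using yw_le[OF k] by (rule weighted_sum_bound)
  then have "l * r * (S x powr (r - 1) * \<bar>\<Sum>w\<in>W. p w x * (y w x (fst k) * w (snd k))\<bar>)
      \<le> l * r * (S x powr (r - 1) * S x)"
    using l_pos r_pos by (intro mult_left_mono) auto
  then show ?thesis
    using l_pos r_pos by (simp add: D_def abs_mult S_powr_mult mult.assoc)
qed

lemma D2_bound:
  assumes k: "k \<in> I"
  shows "\<bar>D2 k x\<bar> \<le> (r * (1 - r) * l\<^sup>2 + r * (l\<^sup>2 + l / \<delta>)) * H x"
proof -
  let ?A = "\<Sum>w\<in>W. p w x * (y w x (fst k) * w (snd k))"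
  let ?f = "\<lambda>w. l\<^sup>2 * ((y w x (fst k))\<^sup>2 * (w (snd k))\<^sup>2) - l * (y2 w x (fst k) * (w (snd k))\<^sup>2)"
  have "\<bar>?A\<bar> \<le> 1 * S x"
    using yw_le[OF k] by (rule weighted_sum_bound)
  then have A: "?A\<^sup>2 \<le> (S x)\<^sup>2"
    using S_pos[of x] by (simp add: abs_le_square_iff[symmetric])
  have f: "\<bar>?f w\<bar> \<le> l\<^sup>2 + l / \<delta>" if w: "w \<in> W" for w
  proof -
    have w1: "(w (snd k))\<^sup>2 \<le> 1" and y1: "(y w x (fst k))\<^sup>2 \<le> 1"
      using k w_le[OF w, of "snd k"] y_le[of w x "fst k"] by (auto simp: I_def abs_square_le_1)
    have a: "l\<^sup>2 * ((y w x (fst k))\<^sup>2 * (w (snd k))\<^sup>2) \<le> l\<^sup>2 * (1 * 1)"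
      using w1 y1 by (intro mult_left_mono mult_mono) auto
    have b: "l * (y2 w x (fst k) * (w (snd k))\<^sup>2) \<le> l * (1 / \<delta> * 1)"
      using w1 y2_bounds[of w x "fst k"] l_pos \<delta>_pos by (intro mult_left_mono mult_mono) auto
    have "0 \<le> l\<^sup>2 * ((y w x (fst k))\<^sup>2 * (w (snd k))\<^sup>2)" "0 \<le> l * (y2 w x (fst k) * (w (snd k))\<^sup>2)"
      "0 \<le> l\<^sup>2" "0 \<le> l / \<delta>"
      using y2_bounds[of w x "fst k"] l_pos \<delta>_pos by auto
    with a[simplified] b[simplified] show ?thesis by linarith
  qed
  have "\<bar>r * (r - 1) * l\<^sup>2 * S x powr (r - 2) * ?A\<^sup>2\<bar> = r * (1 - r) * l\<^sup>2 * (S x powr (r - 2) * ?A\<^sup>2)"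
    using r_pos r_le by (simp add: abs_mult)
  also have "\<dots> \<le> r * (1 - r) * l\<^sup>2 * (S x powr (r - 2) * (S x)\<^sup>2)"
    using r_pos r_le A by (intro mult_left_mono) auto
  finally have 1: "\<bar>r * (r - 1) * l\<^sup>2 * S x powr (r - 2) * ?A\<^sup>2\<bar> \<le> r * (1 - r) * l\<^sup>2 * H x"
    by (simp add: S_powr_mult_square)
  have "\<bar>r * S x powr (r - 1) * (\<Sum>w\<in>W. p w x * ?f w)\<bar> = r * (S x powr (r - 1) * \<bar>\<Sum>w\<in>W. p w x * ?f w\<bar>)"
    using r_pos by (simp add: abs_mult)
  also have "\<dots> \<le> r * (S x powr (r - 1) * ((l\<^sup>2 + l / \<delta>) * S x))"
    using r_pos weighted_sum_bound[OF f] by (intro mult_left_mono) auto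
  also have "\<dots> = r * (l\<^sup>2 + l / \<delta>) * (S x powr (r - 1) * S x)"
    by (simp add: mult_ac)
  finally have 2: "\<bar>r * S x powr (r - 1) * (\<Sum>w\<in>W. p w x * ?f w)\<bar> \<le> r * (l\<^sup>2 + l / \<delta>) * H x"
    by (simp add: S_powr_mult)
  show ?thesis
    unfolding D2_def using abs_triangle_ineq 1 2 by (rule order_trans[OF _ order_trans[OF add_mono]]) (simp add: distrib_right)
qed

text \<open>The matrix entries and the corner, that is, the process on the left of the comparison.
  The complement in \<open>I\<close> consists of the column g and the row h.\<close>

definition J :: "(nat \<times> nat) set" where "J = insert (m, n) ({..<m} \<times> {..<n})"

lemma J_subset: "J \<subseteq> I"
  by (auto simp: I_def J_def)

text \<open>The product of a row sign and a column sign is 1 exactly on \<open>J\<close>, where the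
  corner gets it as a product of two minus signs. This product structure is what lets the signed sum
  factor.\<close>

definition sgn_row :: "nat \<Rightarrow> real" where "sgn_row i = (if i < m then 1 else - 1)"
definition sgn_col :: "nat \<Rightarrow> real" where "sgn_col j = (if j < n then 1 else - 1)"

lemma sum_sgn_row: "(\<Sum>i\<le>m. sgn_row i * f i) = (\<Sum>i<m. f i) - f m"
proof -
  have "{..m} = insert m {..<m}" by auto
  then show ?thesis by (simp add: sgn_row_def)
qed

lemma sum_sgn_col: "(\<Sum>j\<le>n. sgn_col j * f j) = (\<Sum>j<n. f j) - f n"
proof -
  have "{..n} = insert n {..<n}" by auto
  then show ?thesis by (simp add: sgn_col_def)
qed

lemma sum_signed:
  "(\<Sum>k\<in>J. f k) - (\<Sum>k\<in>I - J. f k) = (\<Sum>i\<le>m. \<Sum>j\<le>n. sgn_row i * sgn_col j * f (i, j))"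
proof -
  have "(\<Sum>i\<le>m. \<Sum>j\<le>n. sgn_row i * sgn_col j * f (i, j))
      = (\<Sum>k\<in>I. sgn_row (fst k) * sgn_col (snd k) * f k)"
    by (simp add: sum_I)
  also have "\<dots> = (\<Sum>k\<in>I - J. sgn_row (fst k) * sgn_col (snd k) * f k) + (\<Sum>k\<in>J. sgn_row (fst k) * sgn_col (snd k) * f k)"
    by (rule sum.subset_diff[OF J_subset finite_I])
  also have "(\<Sum>k\<in>I - J. sgn_row (fst k) * sgn_col (snd k) * f k) = (\<Sum>k\<in>I - J. - f k)"
    by (intro sum.cong) (auto simp: I_def J_def sgn_row_def sgn_col_def)
  also have "(\<Sum>k\<in>J. sgn_row (fst k) * sgn_col (snd k) * f k) = (\<Sum>k\<in>J. f k)"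
    by (intro sum.cong) (auto simp: J_def sgn_row_def sgn_col_def)
  finally show ?thesis by (simp add: sum_negf)
qed

lemma sum_signed_prod:
  "(\<Sum>i\<le>m. \<Sum>j\<le>n. sgn_row i * sgn_col j * (f i * g j))
    = ((\<Sum>i<m. f i) - f m) * ((\<Sum>j<n. g j) - g n)"
  unfolding sum_sgn_row[symmetric] sum_sgn_col[symmetric] sum_product by (simp add: mult_ac)

lemma sum_mult_le_one:
  fixes f g :: "nat \<Rightarrow> real"
  assumes "(\<Sum>i<N. (f i)\<^sup>2) \<le> 1" "(\<Sum>i<N. (g i)\<^sup>2) \<le> 1"
  shows "(\<Sum>i<N. f i * g i) \<le> 1"
proof -
  have "f i * g i \<le> ((f i)\<^sup>2 + (g i)\<^sup>2) / 2" for i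
    using sum_squares_bound[of "f i" "g i"] by simp
  then have "(\<Sum>i<N. f i * g i) \<le> (\<Sum>i<N. ((f i)\<^sup>2 + (g i)\<^sup>2) / 2)"
    by (rule sum_mono)
  also have "\<dots> = ((\<Sum>i<N. (f i)\<^sup>2) + (\<Sum>i<N. (g i)\<^sup>2)) / 2"
    by (simp add: sum.distrib flip: sum_divide_distrib)
  finally show ?thesis using assms by simp
qed

text \<open>For a pair \<open>w\<close>, \<open>v\<close> the signed sum of the mixed terms factors as
  \<open>(1 - \<langle>y w, y v\<rangle>) (1 - \<langle>w, v\<rangle>) \<ge> 0\<close>, and it vanishes for the diagonal terms since \<open>w\<close> is
  a unit vector.\<close>

lemma D2_sign: "(\<Sum>k\<in>J. D2 k x) \<le> (\<Sum>k\<in>I - J. D2 k x)"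
proof -
  let ?s = "\<lambda>i j. sgn_row i * sgn_col j"
  let ?A = "\<lambda>i j. \<Sum>w\<in>W. p w x * (y w x i * w j)"
  let ?B = "\<lambda>w i j. l\<^sup>2 * ((y w x i)\<^sup>2 * (w j)\<^sup>2) - l * (y2 w x i * (w j)\<^sup>2)"
  have "(\<Sum>i\<le>m. \<Sum>j\<le>n. ?s i j * (?A i j)\<^sup>2)
      = (\<Sum>i\<le>m. \<Sum>j\<le>n. \<Sum>w\<in>W. \<Sum>v\<in>W. p w x * p v x * (?s i j * ((y w x i * y v x i) * (w j * v j))))"
    unfolding power2_eq_square sum_product by (simp add: sum_distrib_left mult_ac)
  also have "\<dots> = (\<Sum>w\<in>W. \<Sum>v\<in>W. p w x * p v x * (\<Sum>i\<le>m. \<Sum>j\<le>n. ?s i j * ((y w x i * y v x i) * (w j * v j))))"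
    unfolding sum_distrib_left
    by (subst (2) sum.swap, subst sum.swap, intro sum.cong refl, subst (2) sum.swap, subst sum.swap) simp
  also have "\<dots> \<ge> 0"
  proof (rule sum_nonneg, rule sum_nonneg, rule mult_nonneg_nonneg)
    fix w v assume wv: "w \<in> W" "v \<in> W"
    have "(\<Sum>i<m. y w x i * y v x i) \<le> 1"
      by (intro sum_mult_le_one sum_y_square)
    moreover have "(\<Sum>j<n. w j * v j) \<le> 1"
      using wv by (intro sum_mult_le_one) (auto simp: unit)
    ultimately show "0 \<le> (\<Sum>i\<le>m. \<Sum>j\<le>n. ?s i j * ((y w x i * y v x i) * (w j * v j)))"
      unfolding sum_signed_prod using wv
      by (intro mult_nonpos_nonpos) (auto simp: y_def last_coord)
  qed (simp add: less_imp_le[OF p_pos])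
  finally have A: "0 \<le> (\<Sum>i\<le>m. \<Sum>j\<le>n. ?s i j * (?A i j)\<^sup>2)" .
  have "(\<Sum>i\<le>m. \<Sum>j\<le>n. ?s i j * (\<Sum>w\<in>W. p w x * ?B w i j))
      = (\<Sum>i\<le>m. \<Sum>j\<le>n. \<Sum>w\<in>W. p w x * (?s i j * ?B w i j))"
    by (simp add: sum_distrib_left mult_ac)
  also have "\<dots> = (\<Sum>w\<in>W. p w x * (\<Sum>i\<le>m. \<Sum>j\<le>n. ?s i j * ?B w i j))"
    unfolding sum_distrib_left
    by (subst (2) sum.swap, subst sum.swap) simp
  also have "\<dots> = 0"
  proof (intro sum.neutral ballI)
    fix w assume w: "w \<in> W"
    have "(\<Sum>i\<le>m. \<Sum>j\<le>n. ?s i j * ?B w i j)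
        = (\<Sum>i\<le>m. \<Sum>j\<le>n. ?s i j * ((l\<^sup>2 * (y w x i)\<^sup>2 - l * y2 w x i) * (w j)\<^sup>2))"
      by (simp add: algebra_simps)
    then show "p w x * (\<Sum>i\<le>m. \<Sum>j\<le>n. ?s i j * ?B w i j) = 0"
      unfolding sum_signed_prod using w by (simp add: unit last_coord)
  qed
  finally have B: "(\<Sum>i\<le>m. \<Sum>j\<le>n. ?s i j * (\<Sum>w\<in>W. p w x * ?B w i j)) = 0" .
  \<comment> \<open>All that remains is the mixed sum times \<open>r * (r - 1)\<close>, which is
    nonpositive because the outer power is concave; for \<open>r = 1\<close> the two sides would
    coincide.\<close>
  have "(\<Sum>k\<in>J. D2 k x) - (\<Sum>k\<in>I - J. D2 k x)
      = r * (r - 1) * l\<^sup>2 * S x powr (r - 2) * (\<Sum>i\<le>m. \<Sum>j\<le>n. ?s i j * (?A i j)\<^sup>2)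
      + r * S x powr (r - 1) * (\<Sum>i\<le>m. \<Sum>j\<le>n. ?s i j * (\<Sum>w\<in>W. p w x * ?B w i j))"
    unfolding sum_signed D2_def fst_conv snd_conv
    by (simp only: sum_distrib_left sum.distrib distrib_left) (simp only: mult_ac)
  also have "\<dots> \<le> 0"
    using A r_pos r_le unfolding B by (auto intro!: mult_nonpos_nonneg mult_nonneg_nonpos mult_nonneg_nonneg simp: mult_le_0_iff)
  finally show ?thesis by simp
qed

theorem gordon_comparison:
  "(\<integral>x. H (\<lambda>k. (if k \<in> J then 1 else 0) * x k) \<partial>PiM I (\<lambda>_. gauss))
    \<le> (\<integral>x. H (\<lambda>k. (if k \<in> J then 0 else 1) * x k) \<partial>PiM I (\<lambda>_. gauss))"
proof -
  \<comment> \<open>One constant covers \<open>H\<close> (factor 1), \<open>D\<close> (factor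
    \<open>l * r\<close>) and \<open>D2\<close> (the third entry).\<close>
  define C where "C = max 1 (max (l * r) (r * (1 - r) * l\<^sup>2 + r * (l\<^sup>2 + l / \<delta>)))"
  have bound: "c * H x \<le> C * card W * exp (l * (\<Sum>k\<in>I. \<bar>x k\<bar>))" if "c \<le> C" for c x
  proof -
    have "c * H x \<le> C * (card W * exp (l * (\<Sum>k\<in>I. \<bar>x k\<bar>)))"
      using that H_bound H_nonneg by (intro mult_mono) (auto simp: C_def)
    then show ?thesis by (simp add: mult.assoc)
  qed
  show ?thesis
  proof (rule gauss_interpolation[where D = D and ?D2.0 = D2 and K = l and C = "C * card W"])
    show "\<bar>H x\<bar> \<le> C * card W * exp (l * (\<Sum>k\<in>I. \<bar>x k\<bar>))" for x
      using bound[of 1 x] H_nonneg[of x] by (simp add: C_def)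
    show "\<bar>D k x\<bar> \<le> C * card W * exp (l * (\<Sum>k\<in>I. \<bar>x k\<bar>))" if "k \<in> I" for k x
      by (rule order_trans[OF D_bound[OF that] bound]) (simp add: C_def)
    show "\<bar>D2 k x\<bar> \<le> C * card W * exp (l * (\<Sum>k\<in>I. \<bar>x k\<bar>))" if "k \<in> I" for k x
      by (rule order_trans[OF D2_bound[OF that] bound]) (simp add: C_def)
    show "((\<lambda>t. D k (x(k := t))) has_real_derivative D2 k (x(k := t))) (at t)" if "k \<in> I" for k x t
      using D_line_deriv[of "fst k" "snd k"] that by simp
    show "isCont (\<lambda>t. D2 k (x(k := t))) t" if "k \<in> I" for k x t
      using D2_line_cont[of "fst k" "snd k"] that by simp
  qed (use l_pos finite_I J_subset H_deriv D_measurable D2_measurable D2_sign in auto)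
qed

end

section \<open>Escape from a net\<close>

text \<open>Coordinates outside \<open>K\<close> receive the factor 1, which integrates to 1; the
  applications involve only part of the index set.\<close>

lemma gauss_PiM_prod_subset:
  fixes f :: "'i \<Rightarrow> real \<Rightarrow> real"
  assumes fin: "finite I" and K: "K \<subseteq> I" and f: "\<And>k. k \<in> K \<Longrightarrow> integrable gauss (f k)"
  shows "has_bochner_integral (PiM I (\<lambda>_. gauss)) (\<lambda>x. \<Prod>k\<in>K. f k (x k)) (\<Prod>k\<in>K. \<integral>z. f k z \<partial>gauss)"
proof -
  define g where "g k = (if k \<in> K then f k else (\<lambda>_. 1))" for k
  have int: "integrable gauss (g k)" for k
    using f by (simp add: g_def)
  have eq: "(\<Prod>k\<in>K. f k (x k)) = (\<Prod>k\<in>I. g k (x k))" for x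
    using fin K by (auto simp: g_def intro!: prod.mono_neutral_cong_left)
  have eq': "(\<Prod>k\<in>K. \<integral>z. f k z \<partial>gauss) = (\<Prod>k\<in>I. \<integral>z. g k z \<partial>gauss)"
    using fin K by (auto simp: g_def gauss.prob_space[simplified] intro!: prod.mono_neutral_cong_left)
  show ?thesis
    unfolding eq eq' has_bochner_integral_iff
    using fin int by (auto intro!: gauss_product.product_integrable_prod gauss_product.product_integral_prod)
qed

text \<open>Above the threshold \<open>b\<close> the first term suffices; below it the second is at
  least one. The norm of g does not split over coordinates but its square does, so the second term
  has a product expectation.\<close>

lemma exp_minus_le_tail:
  fixes b c t x :: real
  assumes "0 \<le> c" "0 \<le> t" "0 \<le> x" "0 \<le> b"
  shows "exp (- c * x) \<le> exp (- c * b) + exp (t * b\<^sup>2) * exp (- t * x\<^sup>2)"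
proof (cases "b \<le> x")
  case True
  then have "exp (- c * x) \<le> exp (- c * b)"
    using assms by (simp add: mult_left_mono)
  then show ?thesis by (simp add: add_increasing2)
next
  case False
  then have "x\<^sup>2 \<le> b\<^sup>2" using assms by (intro power_mono) auto
  then have "1 \<le> exp (t * b\<^sup>2) * exp (- t * x\<^sup>2)"
    using assms by (simp add: mult_left_mono flip: exp_add)
  moreover have "exp (- c * x) \<le> 1"
    using assms by simp
  ultimately show ?thesis
    using exp_ge_zero[of "- c * b"] by linarith
qed

lemma gauss_matrix_measurable_component:
  "i < m \<Longrightarrow> j < n \<Longrightarrow> (\<lambda>A. A (i, j)) \<in> borel_measurable (gauss_matrix m n)"
  unfolding gauss_matrix_def by (auto intro!: measurable_component_singleton cong: measurable_cong_sets)

lemma matvec_measurable [measurable]: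
  "i < m \<Longrightarrow> (\<lambda>A. matvec n A w i) \<in> borel_measurable (gauss_matrix m n)"
  unfolding matvec_def by (intro borel_measurable_sum borel_measurable_times borel_measurable_const gauss_matrix_measurable_component) auto

lemma prob_space_gauss_matrix: "prob_space (gauss_matrix m n)"
  unfolding gauss_matrix_def by (intro prob_space_PiM prob_space_gauss)

text \<open>\<open>(1 + ln (card W))\<^sup>-\<^sup>1\<close> as the exponent \<open>r\<close> reduces the cost of replacing
  the maximum over \<open>W\<close> by a sum to a constant factor.\<close>

lemma gordon_escape_net:
  fixes W :: "(nat \<Rightarrow> real) set" and \<phi> :: "nat \<Rightarrow> real \<Rightarrow> real"
  assumes W: "finite W" "W \<noteq> {}" and unit: "\<And>w. w \<in> W \<Longrightarrow> (\<Sum>j<n. (w j)\<^sup>2) = 1"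
    and c: "0 < c" and \<rho>: "0 \<le> \<rho>" "c * \<rho> \<le> 1" and t: "0 \<le> t" and b: "0 \<le> b"
    and \<phi>: "\<And>w h. w \<in> W \<Longrightarrow> - (\<Sum>j<n. h j * w j) \<le> \<Gamma> + (\<Sum>j<n. \<phi> j (h j))"
    and \<phi>_int: "\<And>j. j < n \<Longrightarrow> integrable gauss (\<lambda>z. exp (c * \<phi> j z))"
  shows "measure (gauss_matrix m n) {A \<in> space (gauss_matrix m n). \<exists>w\<in>W. (\<Sum>i<m. (matvec n A w i)\<^sup>2) \<le> \<rho>\<^sup>2}
    \<le> exp 3 * ((exp (- c * b) + exp (t * b\<^sup>2) * (\<integral>z. exp (- t * z\<^sup>2) \<partial>gauss) ^ m)
        * (exp (c * \<Gamma>) * (\<Prod>j<n. \<integral>z. exp (c * \<phi> j z) \<partial>gauss)))"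
    (is "measure ?G ?B \<le> exp 3 * ?R")
proof -
  \<comment> \<open>\<open>matvec n\<close> and the unit condition read only coordinates below
    \<open>n\<close>, so coordinate \<open>n\<close> is free to carry the value 1 that the process
    requires.\<close>
  define V where "V = (\<lambda>w. w(n := 1)) ` W"
  define r where "r = 1 / (1 + ln (card V))"
  have V: "finite V" "V \<noteq> {}" using W by (auto simp: V_def)
  then have card_V: "1 \<le> card V" by (simp add: Suc_le_eq card_gt_0_iff)
  then have ln_V: "0 \<le> ln (card V)" by simp
  then have r: "0 < r" "r \<le> 1" by (auto simp: r_def)
  have "ln (card V) * r \<le> 1"
    using ln_V by (simp add: r_def)
  then have card_r: "real (card V) powr r \<le> exp 1"
    using card_V by (simp add: powr_def mult.commute)
  interpret softmin_process m n V "1 / c" r "c / r"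
  proof
    show "(\<Sum>j<n. (w j)\<^sup>2) = 1" if "w \<in> V" for w
      using that unit by (auto simp: V_def)
  qed (use V c r in \<open>auto simp: V_def\<close>)
  let ?P = "PiM I (\<lambda>_. gauss)" and ?I0 = "{..<m} \<times> {..<n}"
  have p_powr: "p w x powr r = exp (- c * nrm w x) * exp (- c * lin w x m)" for w x
  proof -
    have "(- (c / r) * (a + b)) * r = - c * a + - c * b" for a b
      using r by (simp add: field_simps)
    then show ?thesis
      unfolding p_def exp_powr_real exp_add[symmetric] by simp
  qed
  interpret G: prob_space ?G by (rule prob_space_gauss_matrix)
  have B[measurable]: "?B \<in> sets ?G"
    using W by measurable
  define Q where "Q x = (indicator ?B (restrict x ?I0) :: real)" for x
  have I0_I: "?I0 \<subseteq> I - {(m, n)}" by (auto simp: I_def)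
  have Q_meas: "Q \<in> borel_measurable (PiM K (\<lambda>_. gauss))" if "?I0 \<subseteq> K" for K
  proof -
    have "(\<lambda>x. restrict x ?I0) \<in> PiM K (\<lambda>_. gauss) \<rightarrow>\<^sub>M ?G"
      unfolding gauss_matrix_def using that by (rule measurable_restrict_subset)
    then show ?thesis
      unfolding Q_def by (rule measurable_compose) (use B in measurable)
  qed
  have "Q (x(k := z)) = Q x" if "k \<notin> ?I0" for x k z
    using that by (auto simp: Q_def restrict_def fun_eq_iff intro!: arg_cong[where f = "indicator ?B"])
  then have Q_upd: "Q (x((m, n) := z)) = Q x" for x z by simp
  have Q_le: "0 \<le> Q x" "Q x \<le> 1" for x by (auto simp: Q_def)
  have Q_int: "integrable ?P (\<lambda>x. Q x * (1 - c * x (m, n)))"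
  proof (rule integrable_gauss_PiM_exp_bounded[OF finite_I])
    have [measurable]: "Q \<in> borel_measurable ?P" using I0_I by (intro Q_meas) auto
    have "(\<lambda>x. x (m, n)) \<in> borel_measurable ?P"
      by (auto intro!: measurable_component_singleton simp: I_def cong: measurable_cong_sets)
    then show "(\<lambda>x. Q x * (1 - c * x (m, n))) \<in> borel_measurable ?P" by measurable
    fix x :: "nat \<times> nat \<Rightarrow> real"
    have "(m, n) \<in> I" by (simp add: I_def)
    then have "\<bar>x (m, n)\<bar> \<le> (\<Sum>k\<in>I. \<bar>x k\<bar>)"
      using finite_I by (intro member_le_sum) auto
    also have "\<dots> \<le> exp (\<Sum>k\<in>I. \<bar>x k\<bar>)"
      using exp_ge_add_one_self[of "\<Sum>k\<in>I. \<bar>x k\<bar>"] by linarith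
    finally have "c * \<bar>x (m, n)\<bar> \<le> c * exp (\<Sum>k\<in>I. \<bar>x k\<bar>)"
      using c by simp
    moreover have "1 \<le> exp (\<Sum>k\<in>I. \<bar>x k\<bar>)" by (simp add: sum_nonneg)
    moreover have "\<bar>1 - c * x (m, n)\<bar> \<le> 1 + c * \<bar>x (m, n)\<bar>"
      using abs_triangle_ineq4[of 1 "c * x (m, n)"] c by (simp add: abs_mult)
    ultimately have "\<bar>1 - c * x (m, n)\<bar> \<le> (1 + c) * exp (1 * (\<Sum>k\<in>I. \<bar>x k\<bar>))"
      unfolding distrib_right mult_1 by linarith
    moreover have "\<bar>Q x\<bar> * \<bar>1 - c * x (m, n)\<bar> \<le> 1 * \<bar>1 - c * x (m, n)\<bar>"
      using Q_le by (intro mult_right_mono) auto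
    ultimately show "\<bar>Q x * (1 - c * x (m, n))\<bar> \<le> (1 + c) * exp (1 * (\<Sum>k\<in>I. \<bar>x k\<bar>))"
      by (simp add: abs_mult)
  qed
  have "measure ?G ?B = (\<integral>x. indicator ?B x \<partial>?G)"
    using B by simp
  also have "\<dots> = (\<integral>x. Q x \<partial>PiM (I - {(m, n)}) (\<lambda>_. gauss))"
  proof -
    have meas: "(\<lambda>x. restrict x ?I0) \<in> PiM (I - {(m, n)}) (\<lambda>_. gauss) \<rightarrow>\<^sub>M ?G"
      unfolding gauss_matrix_def using I0_I by (rule measurable_restrict_subset)
    interpret pp: product_prob_space "\<lambda>_. gauss" "I - {(m, n)}"
      by unfold_locales
    have "distr (PiM (I - {(m, n)}) (\<lambda>_. gauss)) ?G (\<lambda>x. restrict x ?I0) = ?G"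
      unfolding gauss_matrix_def using I0_I finite_I
      by (intro pp.distr_PiM_restrict_finite) auto
    then have "(\<integral>x. indicator ?B x \<partial>?G)
        = (\<integral>x. indicator ?B x \<partial>distr (PiM (I - {(m, n)}) (\<lambda>_. gauss)) ?G (\<lambda>x. restrict x ?I0))"
      by simp
    also have "\<dots> = (\<integral>x. Q x \<partial>PiM (I - {(m, n)}) (\<lambda>_. gauss))"
      unfolding Q_def by (subst integral_distr[OF meas borel_measurable_indicator[OF B]]) simp
    finally show ?thesis .
  qed
  \<comment> \<open>\<open>Q\<close> ignores the corner, which has mean zero, so the inserted factor
    integrates to one. It is chosen because \<open>1 - c * z \<le> exp (- c * z)\<close> then
    produces the corner term of the process pointwise.\<close>
  also have "\<dots> = (\<integral>x. Q x * (1 - c * x (m, n)) \<partial>?P)"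
  proof -
    have "(\<integral>z. z \<partial>gauss) = 0"
      using integral_std_normal_moment_odd[of 0] by (subst gauss_integral) auto
    moreover have "integrable gauss (\<lambda>z. z)"
      using integrable_std_normal_moment[of 1] by (subst gauss_integrable_iff) auto
    ultimately have "(\<integral>z. 1 - c * z \<partial>gauss) = 1"
      by (simp add: gauss.prob_space[simplified])
    moreover have "insert (m, n) (I - {(m, n)}) = I" by (auto simp: I_def)
    ultimately show ?thesis
      using gauss_product.product_integral_insert[of "I - {(m, n)}" "(m, n)" "\<lambda>x. Q x * (1 - c * x (m, n))"]
        finite_I Q_int by (simp add: Q_upd)
  qed
  also have "\<dots> \<le> (\<integral>x. exp 2 * H (\<lambda>k. (if k \<in> J then 1 else 0) * x k) \<partial>?P)"
  proof (rule integral_mono[OF Q_int])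
    show "integrable ?P (\<lambda>x. exp 2 * H (\<lambda>k. (if k \<in> J then 1 else 0) * x k))"
      by (intro integrable_mult_right H_integrable) auto
    fix x :: "nat \<times> nat \<Rightarrow> real"
    let ?z = "\<lambda>k. (if k \<in> J then 1 else 0) * x k"
    show "Q x * (1 - c * x (m, n)) \<le> exp 2 * H ?z"
    proof (cases "restrict x ?I0 \<in> ?B")
      case False
      then show ?thesis using H_nonneg by (simp add: Q_def)
    next
      case True
      then obtain w where w: "w \<in> W" "(\<Sum>i<m. (matvec n (restrict x ?I0) w i)\<^sup>2) \<le> \<rho>\<^sup>2"
        by blast
      let ?w = "w(n := 1)"
      have lin_i: "lin ?w ?z i = matvec n (restrict x ?I0) w i" if "i < m" for i
      proof -
        have "{..n} = insert n {..<n}" by auto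
        with that show ?thesis by (auto simp: lin_def matvec_def J_def intro!: sum.cong)
      qed
      have lin_m: "lin ?w ?z m = x (m, n)"
      proof -
        have "{..n} = insert n {..<n}" by auto
        then show ?thesis by (auto simp: lin_def J_def intro!: sum.neutral)
      qed
      \<comment> \<open>After multiplication by \<open>c\<close>, the smoothing and the tolerance
        \<open>\<rho>\<close> each contribute at most one; hence the factor
        \<open>exp 2\<close>.\<close>
      have "nrm ?w ?z \<le> 1 / c + \<rho>"
      proof -
        have "(1 / c)\<^sup>2 + (\<Sum>i<m. (lin ?w ?z i)\<^sup>2) \<le> (1 / c)\<^sup>2 + \<rho>\<^sup>2"
          using w by (simp add: lin_i)
        also have "\<dots> \<le> (1 / c + \<rho>)\<^sup>2"
          using c \<rho> by (simp add: power2_sum)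
        finally show ?thesis
          unfolding nrm_def using c \<rho> by (intro real_le_lsqrt) auto
      qed
      then have "c * nrm ?w ?z \<le> 2"
        using mult_left_mono[of "nrm ?w ?z" "1 / c + \<rho>" c] c \<rho> by (simp add: distrib_left)
      then have "1 \<le> exp 2 * exp (- c * nrm ?w ?z)"
        by (simp flip: exp_add)
      then have "1 * exp (- c * x (m, n)) \<le> exp 2 * exp (- c * nrm ?w ?z) * exp (- c * x (m, n))"
        by (intro mult_right_mono) auto
      then have "exp (- c * x (m, n)) \<le> exp 2 * p ?w ?z powr r"
        unfolding p_powr lin_m by (simp only: mult_1 mult.assoc)
      moreover have "p ?w ?z powr r \<le> H ?z"
        unfolding H_def
      proof (rule powr_mono2)
        show "p ?w ?z \<le> S ?z"
        proof -
          have "?w \<in> V"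
            unfolding V_def using w(1) by (rule imageI)
          then show ?thesis
            unfolding S_def by (rule member_le_sum) (use finite_W p_pos in \<open>auto simp: less_imp_le\<close>)
        qed
      qed (use r p_pos in \<open>auto simp: less_imp_le\<close>)
      then have "exp 2 * p ?w ?z powr r \<le> exp 2 * H ?z"
        by simp
      moreover have "Q x * (1 - c * x (m, n)) \<le> exp (- c * x (m, n))"
        using True exp_ge_add_one_self[of "- c * x (m, n)"] by (simp add: Q_def)
      ultimately show ?thesis
        by linarith
    qed
  qed
  also have "\<dots> = exp 2 * (\<integral>x. H (\<lambda>k. (if k \<in> J then 1 else 0) * x k) \<partial>?P)"
    by simp
  also have "\<dots> \<le> exp 2 * (\<integral>x. H (\<lambda>k. (if k \<in> J then 0 else 1) * x k) \<partial>?P)"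
    using gordon_comparison by simp
  also have "\<dots> \<le> exp 2 * (exp 1 * ?R)"
  proof (intro mult_left_mono)
    define K1 K2 where "K1 = Pair m ` {..<n}" and "K2 = (\<lambda>i. (i, n)) ` {..<m}"
    define f where "f k = (if fst k = m then (\<lambda>z. exp (c * \<phi> (snd k) z)) else (\<lambda>z. exp (- t * z\<^sup>2)))" for k :: "nat \<times> nat"
    have K: "K1 \<subseteq> I" "K1 \<union> K2 \<subseteq> I" by (auto simp: I_def K1_def K2_def)
    have "integrable gauss (\<lambda>z. exp (- t * z\<^sup>2))"
      using t by (intro gauss_integrable_exp_bounded[where C = 1 and K = 0]) auto
    then have f: "integrable gauss (f k)" if "k \<in> K1 \<union> K2" for k
      using that \<phi>_int by (cases k) (auto simp: f_def K1_def K2_def)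
    have prod1: "(\<Prod>k\<in>K1. g k) = (\<Prod>j<n. g (m, j))" for g :: "nat \<times> nat \<Rightarrow> real"
      unfolding K1_def by (subst prod.reindex) (auto simp: inj_on_def)
    have prod2: "(\<Prod>k\<in>K1 \<union> K2. g k) = (\<Prod>i<m. g (i, n)) * (\<Prod>j<n. g (m, j))" for g :: "nat \<times> nat \<Rightarrow> real"
    proof -
      have "(\<Prod>k\<in>K1 \<union> K2. g k) = (\<Prod>k\<in>K1. g k) * (\<Prod>k\<in>K2. g k)"
        by (rule prod.union_disjoint) (auto simp: K1_def K2_def)
      also have "(\<Prod>k\<in>K2. g k) = (\<Prod>i<m. g (i, n))"
        unfolding K2_def by (subst prod.reindex) (auto simp: inj_on_def)
      finally show ?thesis by (simp add: prod1 mult.commute)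
    qed
    \<comment> \<open>A majorant made of two products, one over the last row and one over the last
      row and column, so that its integral is computed coordinate by coordinate.\<close>
    define F where "F x = exp 1 * exp (c * \<Gamma>) *
      (exp (- c * b) * (\<Prod>k\<in>K1. f k (x k)) + exp (t * b\<^sup>2) * (\<Prod>k\<in>K1 \<union> K2. f k (x k)))" for x
    have F: "has_bochner_integral ?P F (exp 1 * exp (c * \<Gamma>) *
        (exp (- c * b) * (\<Prod>k\<in>K1. \<integral>z. f k z \<partial>gauss) + exp (t * b\<^sup>2) * (\<Prod>k\<in>K1 \<union> K2. \<integral>z. f k z \<partial>gauss)))"
      unfolding F_def
      by (intro has_bochner_integral_mult_right has_bochner_integral_add gauss_PiM_prod_subset[OF finite_I] K f) auto
    have "(\<integral>x. H (\<lambda>k. (if k \<in> J then 0 else 1) * x k) \<partial>?P) \<le> (\<integral>x. F x \<partial>?P)"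
    proof (rule integral_mono)
      show "integrable ?P (\<lambda>x. H (\<lambda>k. (if k \<in> J then 0 else 1) * x k))"
        by (intro H_integrable) auto
      show "integrable ?P F" using F by (rule integrable.intros)
      fix x :: "nat \<times> nat \<Rightarrow> real"
      let ?z = "\<lambda>k. (if k \<in> J then 0 else 1) * x k"
      define X where "X = sqrt (\<Sum>i<m. (x (i, n))\<^sup>2)"
      define Y where "Y = exp (c * \<Gamma>) * (\<Prod>j<n. exp (c * \<phi> j (x (m, j))))"
      have X: "0 \<le> X" "X\<^sup>2 = (\<Sum>i<m. (x (i, n))\<^sup>2)"
        by (auto simp: X_def sum_nonneg)
      have split: "{..n} = insert n {..<n}" by auto
      have lin_i: "lin w ?z i = x (i, n)" if "i < m" "w \<in> V" for i w
        using that by (auto simp: lin_def split J_def last_coord intro!: sum.neutral)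
      have p_le: "p w ?z powr r \<le> exp (- c * X) * Y" if w: "w \<in> V" for w
      proof -
        obtain v where v: "v \<in> W" "w = v(n := 1)" using w by (auto simp: V_def)
        have lin_m: "lin w ?z m = (\<Sum>j<n. x (m, j) * v j)"
          by (auto simp: lin_def split J_def v intro!: sum.cong)
        have "c * - lin w ?z m \<le> c * (\<Gamma> + (\<Sum>j<n. \<phi> j (x (m, j))))"
          unfolding lin_m using c \<phi>[OF v(1)] by (intro mult_left_mono) auto
        then have "exp (- c * lin w ?z m) \<le> exp (c * (\<Gamma> + (\<Sum>j<n. \<phi> j (x (m, j)))))"
          by simp
        also have "\<dots> = Y"
          by (simp add: Y_def distrib_left exp_add exp_sum sum_distrib_left)
        finally have "exp (- c * lin w ?z m) \<le> Y" .
        moreover have "X \<le> nrm w ?z"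
          unfolding X_def nrm_def using w by (simp add: lin_i)
        then have "exp (- c * nrm w ?z) \<le> exp (- c * X)"
          using c by simp
        ultimately show ?thesis
          unfolding p_powr by (intro mult_mono) auto
      qed
      have Y: "0 \<le> Y" by (simp add: Y_def prod_nonneg)
      have "p w ?z \<le> (exp (- c * X) * Y) powr (1 / r)" if "w \<in> V" for w
        using powr_mono2[OF _ _ p_le[OF that], of "1 / r"] r p_pos[of w ?z] by (simp add: powr_powr)
      then have "S ?z \<le> card V * (exp (- c * X) * Y) powr (1 / r)"
        unfolding S_def by (rule sum_bounded_above)
      then have "H ?z \<le> (card V * (exp (- c * X) * Y) powr (1 / r)) powr r"
        unfolding H_def using S_pos r by (intro powr_mono2) (auto simp: less_imp_le)
      also have "\<dots> = card V powr r * (exp (- c * X) * Y)"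
        using r Y by (simp add: powr_mult powr_powr)
      also have "\<dots> \<le> exp 1 * ((exp (- c * b) + exp (t * b\<^sup>2) * exp (- t * X\<^sup>2)) * Y)"
        using card_r Y c t b X by (intro mult_mono mult_right_mono exp_minus_le_tail) auto
      also have "\<dots> = F x"
        unfolding F_def prod1 prod2 Y_def X(2)
        by (simp add: f_def exp_sum sum_distrib_left algebra_simps flip: sum_negf)
      finally show "H ?z \<le> F x" .
    qed
    also have "\<dots> = exp 1 * ?R"
      unfolding has_bochner_integral_integral_eq[OF F] prod1 prod2
      by (simp add: f_def algebra_simps)
    finally show "(\<integral>x. H (\<lambda>k. (if k \<in> J then 0 else 1) * x k) \<partial>?P) \<le> exp 1 * ?R" .
  qed simp
  also have "\<dots> = exp 3 * ?R"
    by (simp flip: exp_add mult.assoc)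
  finally show ?thesis .
qed

section \<open>Exponential moments of the sectional functionals\<close>

lemma qpow_nonneg: "0 \<le> qpow q t"
  by (simp add: qpow_def)

lemma qpow_0 [simp]: "qpow q 0 = 0"
  by (simp add: qpow_def)

lemma qpow_minus [simp]: "qpow q (- t) = qpow q t"
  by (simp add: qpow_def)

lemma qpow_mult: "qpow q (s * t) = qpow q s * qpow q t"
  by (simp add: qpow_def abs_mult powr_mult)

text \<open>Linear growth for every admissible \<open>q\<close>, the discontinuous case
  \<open>q = 0\<close> included, lets the quadratic penalty dominate the power term.\<close>

lemma qpow_le: 
  assumes "0 \<le> q" "q \<le> 1"
  shows "qpow q t \<le> 1 + \<bar>t\<bar>"
proof (cases "q = 0")
  case False
  have "\<bar>t\<bar> powr q \<le> (1 + \<bar>t\<bar>) powr q"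
    using assms by (intro powr_mono2) auto
  also have "\<dots> \<le> (1 + \<bar>t\<bar>) powr 1"
    using assms by (intro powr_mono) auto
  finally show ?thesis using False by (simp add: qpow_def)
qed (simp add: qpow_def)

text \<open>Split \<open>(a + b) powr q\<close> as \<open>a + b\<close> times the power
  \<open>q - 1\<close>. That power is decreasing, so in each summand \<open>a + b\<close> may be
  replaced by \<open>a\<close> or \<open>b\<close>. The counting case and zero arguments are
  separate.\<close>

lemma qpow_add_le:
  assumes "0 \<le> q" "q \<le> 1"
  shows "qpow q (s + t) \<le> qpow q s + qpow q t"
proof (cases "q = 0 \<or> s = 0 \<or> t = 0")
  case False
  define a b where "a = \<bar>s\<bar>" and "b = \<bar>t\<bar>"
  have ab: "0 < a" "0 < b" using False by (auto simp: a_def b_def)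
  have "\<bar>s + t\<bar> powr q \<le> (a + b) powr q"
    using assms by (intro powr_mono2) (auto simp: a_def b_def)
  also have "\<dots> = a * (a + b) powr (q - 1) + b * (a + b) powr (q - 1)"
    using ab powr_mult_base[of "a + b" "q - 1"] by (simp add: distrib_right)
  also have "\<dots> \<le> a * a powr (q - 1) + b * b powr (q - 1)"
    using ab assms by (intro add_mono mult_left_mono powr_mono2') auto
  also have "\<dots> = a powr q + b powr q"
    using ab by (simp add: powr_diff)
  finally show ?thesis
    using False by (simp add: qpow_def a_def b_def)
qed (auto simp: qpow_def)

text \<open>A signed multiplier treats both functionals at once: at
  \<open>z = \<bar>h\<bar>\<close>, \<open>\<kappa> = \<nu>\<close> gives the integrand of I1 and
  \<open>\<kappa> = - \<nu>\<close> that of I2. An infinite supremum would be sent to 0, so the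
  value is meaningful only where finiteness is known, as for \<open>\<gamma> > 0\<close>.\<close>

definition secmax :: "real \<Rightarrow> real \<Rightarrow> real \<Rightarrow> real \<Rightarrow> real" where
  "secmax q \<kappa> \<gamma> z = enn2real (SUP w::real. ennreal (z * \<bar>w\<bar> + \<kappa> * qpow q w - \<gamma> * w\<^sup>2))"

context
  fixes q \<kappa> \<gamma> :: real
  assumes q: "0 \<le> q" "q \<le> 1" and \<gamma>: "0 < \<gamma>"
begin

text \<open>Half of the quadratic penalty absorbs the term in \<open>z\<close>, the other half the
  linear bound on the power term. Quadratic growth in \<open>z\<close> is what a Gaussian tolerates
  in small exponential moments.\<close>

lemma secmax_arg_le:
  "z * \<bar>w\<bar> + \<kappa> * qpow q w - \<gamma> * w\<^sup>2 \<le> (\<bar>\<kappa>\<bar> + \<kappa>\<^sup>2 / (2 * \<gamma>)) + 1 / (2 * \<gamma>) * z\<^sup>2"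
proof -
  have "\<kappa> * qpow q w \<le> \<bar>\<kappa>\<bar> * (1 + \<bar>w\<bar>)"
    by (intro mult_mono qpow_le q qpow_nonneg) auto
  moreover have *: "a * \<bar>w\<bar> \<le> \<gamma> * w\<^sup>2 / 2 + a\<^sup>2 / (2 * \<gamma>)" for a
  proof -
    have "0 \<le> (\<gamma> * \<bar>w\<bar> - a)\<^sup>2"
      by simp
    then show ?thesis
      using \<gamma> by (simp add: power2_eq_square field_simps)
  qed
  moreover have "\<bar>\<kappa>\<bar> * \<bar>w\<bar> \<le> \<gamma> * w\<^sup>2 / 2 + \<kappa>\<^sup>2 / (2 * \<gamma>)"
    using *[of "\<bar>\<kappa>\<bar>"] by simp
  moreover have "1 / (2 * \<gamma>) * z\<^sup>2 = z\<^sup>2 / (2 * \<gamma>)"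
    by simp
  ultimately show ?thesis
    using *[of z] unfolding distrib_left mult_1_right by linarith
qed

lemma ennreal_secmax:
  "ennreal (secmax q \<kappa> \<gamma> z) = (SUP w::real. ennreal (z * \<bar>w\<bar> + \<kappa> * qpow q w - \<gamma> * w\<^sup>2))"
proof -
  have "(SUP w::real. ennreal (z * \<bar>w\<bar> + \<kappa> * qpow q w - \<gamma> * w\<^sup>2))
      \<le> ennreal ((\<bar>\<kappa>\<bar> + \<kappa>\<^sup>2 / (2 * \<gamma>)) + 1 / (2 * \<gamma>) * z\<^sup>2)"
    by (intro SUP_least ennreal_leI secmax_arg_le)
  also have "\<dots> < \<top>" by simp
  finally show ?thesis
    by (simp add: secmax_def)
qed

lemma secmax_nonneg: "0 \<le> secmax q \<kappa> \<gamma> z"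
  by (simp add: secmax_def)

lemma secmax_le: "secmax q \<kappa> \<gamma> z \<le> (\<bar>\<kappa>\<bar> + \<kappa>\<^sup>2 / (2 * \<gamma>)) + 1 / (2 * \<gamma>) * z\<^sup>2"
proof -
  have "ennreal (secmax q \<kappa> \<gamma> z) \<le> ennreal ((\<bar>\<kappa>\<bar> + \<kappa>\<^sup>2 / (2 * \<gamma>)) + 1 / (2 * \<gamma>) * z\<^sup>2)"
    unfolding ennreal_secmax by (intro SUP_least ennreal_leI secmax_arg_le)
  then show ?thesis
    using \<gamma> by (subst (asm) ennreal_le_iff) (auto intro!: add_nonneg_nonneg)
qed

lemma secmax_ge: "z * \<bar>w\<bar> + \<kappa> * qpow q w - \<gamma> * w\<^sup>2 \<le> secmax q \<kappa> \<gamma> z"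
proof -
  have "ennreal (z * \<bar>w\<bar> + \<kappa> * qpow q w - \<gamma> * w\<^sup>2) \<le> ennreal (secmax q \<kappa> \<gamma> z)"
    unfolding ennreal_secmax by (rule SUP_upper) simp
  then show ?thesis
    using secmax_nonneg by (simp add: ennreal_le_iff)
qed

text \<open>The supremum is over an uncountable set, but \<open>z\<close> multiplies
  \<open>\<bar>w\<bar>\<close>, so the function is monotone.\<close>

lemma secmax_measurable [measurable]: "secmax q \<kappa> \<gamma> \<in> borel_measurable borel"
proof (rule borel_measurable_mono, rule monoI)
  fix z z' :: real assume "z \<le> z'"
  then have "ennreal (secmax q \<kappa> \<gamma> z) \<le> ennreal (secmax q \<kappa> \<gamma> z')"
    unfolding ennreal_secmax
    by (intro SUP_mono' ennreal_leI diff_right_mono add_right_mono mult_right_mono) auto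
  then show "secmax q \<kappa> \<gamma> z \<le> secmax q \<kappa> \<gamma> z'"
    using secmax_nonneg by (simp add: ennreal_le_iff)
qed

end

section \<open>Second-order bounds for Gaussian exponential moments\<close>

lemma exp_le_quadratic:
  fixes x :: real
  assumes "0 \<le> x"
  shows "exp x \<le> 1 + x + x\<^sup>2 * exp x"
proof -
  have "exp x * (1 - x) \<le> exp x * exp (- x)"
    using exp_ge_add_one_self[of "- x"] by (intro mult_left_mono) auto
  then have *: "exp x \<le> 1 + x * exp x"
    by (simp add: exp_minus_inverse right_diff_distrib mult.commute)
  then have "x * exp x \<le> x * (1 + x * exp x)"
    using assms by (rule mult_left_mono)
  with * show ?thesis
    by (simp add: power2_eq_square distrib_left mult.assoc)
qed

lemma square_le_exp:
  fixes x :: real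
  assumes "0 \<le> x"
  shows "x\<^sup>2 \<le> 4 * exp x"
proof -
  have "(x / 2)\<^sup>2 \<le> (exp (x / 2))\<^sup>2"
    using assms exp_ge_add_one_self[of "x / 2"] by (intro power_mono) linarith+
  then show ?thesis
    by (simp add: power_divide flip: exp_double)
qed

text \<open>A second-order expansion whose remainder has a majorant independent of \<open>s\<close>:
  the constant \<open>K\<close> is uniform and the first-order coefficient is the exact mean, so
  hypotheses on expectations transfer to exponential moments.\<close>

lemma gauss_exp_moment:
  fixes \<phi> :: "real \<Rightarrow> real"
  assumes [measurable]: "\<phi> \<in> borel_measurable borel"
    and \<phi>: "\<And>z. 0 \<le> \<phi> z" "\<And>z. \<phi> z \<le> C + D * z\<^sup>2" and D: "0 < D"
  obtains s0 K where "0 < s0" "0 \<le> K" "integrable gauss \<phi>"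
    "\<And>s. 0 \<le> s \<Longrightarrow> s \<le> s0 \<Longrightarrow> integrable gauss (\<lambda>z. exp (s * \<phi> z))"
    "\<And>s. 0 \<le> s \<Longrightarrow> s \<le> s0 \<Longrightarrow>
      (\<integral>z. exp (s * \<phi> z) \<partial>gauss) \<le> exp (s * (\<integral>z. \<phi> z \<partial>gauss) + s\<^sup>2 * K)"
proof
  \<comment> \<open>At the doubled rate \<open>2 * s0\<close> the growth bound gives exactly the
    integrable exponent 1/4; the doubling leaves room to absorb the square of \<open>\<phi>\<close>
    into \<open>exp (s0 * \<phi> z)\<close>.\<close>
  define s0 where "s0 = 1 / (8 * D)"
  define E where "E = exp (2 * s0 * C)"
  define K where "K = (\<integral>z. 4 / s0\<^sup>2 * (E * exp (z\<^sup>2 / 4)) \<partial>gauss)"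
  show s0: "0 < s0" using D by (simp add: s0_def)
  show "0 \<le> K" by (simp add: K_def E_def integral_nonneg_AE)
  have int_E: "integrable gauss (\<lambda>z. a * (E * exp (z\<^sup>2 / 4)))" for a
    using gauss_integrable_exp_square by simp
  have exp2: "exp (s * \<phi> z) \<le> E * exp (z\<^sup>2 / 4)" if "s \<le> 2 * s0" for s z
  proof -
    have "s * \<phi> z \<le> 2 * s0 * \<phi> z"
      using that \<phi> by (intro mult_right_mono) auto
    also have "\<dots> \<le> 2 * s0 * (C + D * z\<^sup>2)"
      using s0 \<phi> by (intro mult_left_mono) auto
    also have "\<dots> = 2 * s0 * C + z\<^sup>2 / 4"
      using D by (simp add: s0_def field_simps)
    finally show ?thesis
      by (simp add: E_def flip: exp_add)
  qed
  have int: "integrable gauss (\<lambda>z. exp (s * \<phi> z))" if "s \<le> 2 * s0" for s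
    using exp2[OF that]
    by (intro Bochner_Integration.integrable_bound[OF int_E[of 1]]) (auto intro: order_trans[OF _ abs_ge_self])
  show "integrable gauss (\<lambda>z. exp (s * \<phi> z))" if "0 \<le> s" "s \<le> s0" for s
    using that s0 by (intro int) auto
  show int_\<phi>: "integrable gauss \<phi>"
  proof (rule Bochner_Integration.integrable_bound)
    show "integrable gauss (\<lambda>z. 1 / s0 * exp (s0 * \<phi> z))"
      using s0 by (intro integrable_mult_right int) auto
    have "\<phi> z \<le> 1 / s0 * exp (s0 * \<phi> z)" for z
    proof -
      have "s0 * \<phi> z \<le> exp (s0 * \<phi> z)"
        using exp_ge_add_one_self[of "s0 * \<phi> z"] by linarith
      then show ?thesis
        using s0 by (simp add: field_simps)
    qed
    then show "AE z in gauss. norm (\<phi> z) \<le> norm (1 / s0 * exp (s0 * \<phi> z))"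
      using \<phi>(1) s0 by (auto intro!: AE_I2)
  qed simp
  show "(\<integral>z. exp (s * \<phi> z) \<partial>gauss) \<le> exp (s * (\<integral>z. \<phi> z \<partial>gauss) + s\<^sup>2 * K)" if s: "0 \<le> s" "s \<le> s0" for s
  proof -
    have "exp (s * \<phi> z) \<le> 1 + s * \<phi> z + s\<^sup>2 * (4 / s0\<^sup>2 * (E * exp (z\<^sup>2 / 4)))" for z
    proof -
      have "(s0 * \<phi> z)\<^sup>2 * exp (s * \<phi> z) \<le> 4 * exp (s0 * \<phi> z) * exp (s * \<phi> z)"
        using s0 \<phi>(1) by (intro mult_right_mono square_le_exp) auto
      also have "\<dots> = 4 * exp ((s0 + s) * \<phi> z)"
        by (simp add: distrib_right exp_add)
      also have "\<dots> \<le> 4 * (E * exp (z\<^sup>2 / 4))"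
        using s exp2[of "s0 + s" z] by simp
      finally have "(\<phi> z)\<^sup>2 * exp (s * \<phi> z) \<le> 4 / s0\<^sup>2 * (E * exp (z\<^sup>2 / 4))"
        using s0 by (simp add: field_simps)
      then have "s\<^sup>2 * ((\<phi> z)\<^sup>2 * exp (s * \<phi> z)) \<le> s\<^sup>2 * (4 / s0\<^sup>2 * (E * exp (z\<^sup>2 / 4)))"
        by (rule mult_left_mono) simp
      moreover have "exp (s * \<phi> z) \<le> 1 + s * \<phi> z + (s * \<phi> z)\<^sup>2 * exp (s * \<phi> z)"
        using s \<phi>(1) by (intro exp_le_quadratic) auto
      ultimately show ?thesis
        by (simp add: power_mult_distrib mult.assoc)
    qed
    then have "(\<integral>z. exp (s * \<phi> z) \<partial>gauss)
        \<le> (\<integral>z. 1 + s * \<phi> z + s\<^sup>2 * (4 / s0\<^sup>2 * (E * exp (z\<^sup>2 / 4))) \<partial>gauss)"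
      using int[of s] s s0 int_\<phi> int_E
      by (intro integral_mono Bochner_Integration.integrable_add integrable_mult_right) auto
    also have "\<dots> = 1 + s * (\<integral>z. \<phi> z \<partial>gauss) + s\<^sup>2 * K"
      unfolding K_def using int_\<phi> gauss_integrable_exp_square
      by (simp add: gauss.prob_space[simplified])
    also have "\<dots> \<le> exp (s * (\<integral>z. \<phi> z \<partial>gauss) + s\<^sup>2 * K)"
      using exp_ge_add_one_self[of "s * (\<integral>z. \<phi> z \<partial>gauss) + s\<^sup>2 * K"] by linarith
    finally show ?thesis .
  qed
qed

text \<open>Uses the quadratic upper bound for \<open>exp (- x)\<close> with second moment 1 and
  fourth moment 3. The exponential form is convenient for taking the \<open>m\<close>-th
  power.\<close>

lemma gauss_exp_minus_square_le:
  assumes "0 \<le> t"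
  shows "(\<integral>z. exp (- t * z\<^sup>2) \<partial>gauss) \<le> exp (- t + 3 / 2 * t\<^sup>2)"
proof -
  have even: "integrable gauss (\<lambda>z. z ^ k)" for k
    using integrable_std_normal_moment[of k] by (subst gauss_integrable_iff) auto
  have "(\<integral>z. z\<^sup>2 \<partial>gauss) = 1" "(\<integral>z. z ^ 4 \<partial>gauss) = 3"
    using integral_std_normal_moment_even[of 1] integral_std_normal_moment_even[of 2]
    by (auto simp: gauss_integral fact_numeral)
  note moments = this
  have "exp (- x) \<le> 1 - x + x\<^sup>2 / 2" if "0 \<le> x" for x :: real
  proof -
    have "((\<lambda>x. 1 - x + x\<^sup>2 / 2 - exp (- x)) has_real_derivative - 1 + x + exp (- x)) (at x)" for x :: real
      by (auto intro!: derivative_eq_intros)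
    moreover have "0 \<le> - 1 + x + exp (- x)" for x :: real
      using exp_ge_add_one_self[of "- x"] by simp
    ultimately have "1 - 0 + 0\<^sup>2 / 2 - exp (- 0) \<le> 1 - x + x\<^sup>2 / 2 - exp (- x)"
      using that by (intro DERIV_nonneg_imp_nondecreasing[where f = "\<lambda>x. 1 - x + x\<^sup>2 / 2 - exp (- x)"]) blast+
    then show ?thesis by simp
  qed
  from this[of "t * z\<^sup>2" for z] have "exp (- t * z\<^sup>2) \<le> 1 - t * z\<^sup>2 + t\<^sup>2 / 2 * z ^ 4" for z
    using assms by (simp add: power_mult_distrib flip: power_mult)
  moreover have "integrable gauss (\<lambda>z. exp (- t * z\<^sup>2))"
    using assms by (intro gauss_integrable_exp_bounded[where C = 1 and K = 0]) auto
  ultimately have "(\<integral>z. exp (- t * z\<^sup>2) \<partial>gauss) \<le> (\<integral>z. 1 - t * z\<^sup>2 + t\<^sup>2 / 2 * z ^ 4 \<partial>gauss)"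
    using assms even
    by (intro integral_mono Bochner_Integration.integrable_add Bochner_Integration.integrable_diff integrable_mult_right) auto
  also have "\<dots> = 1 - t + t\<^sup>2 / 2 * 3"
    using even moments by (simp add: gauss.prob_space[simplified])
  also have "\<dots> \<le> exp (- t + 3 / 2 * t\<^sup>2)"
    using exp_ge_add_one_self[of "- t + 3 / 2 * t\<^sup>2"] by (simp add: algebra_simps)
  finally show ?thesis .
qed

lemma gauss_expectation_abs: "(\<integral>\<^sup>+ z. ennreal \<bar>z\<bar> \<partial>gauss) = ennreal (sqrt (2 / pi))"
proof -
  have "integrable gauss (\<lambda>z. \<bar>z\<bar>)"
    using integrable_std_normal_moment_abs[of 1] by (subst gauss_integrable_iff) auto
  moreover have "(\<integral>z. \<bar>z\<bar> \<partial>gauss) = sqrt (2 / pi)"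
    using integral_std_normal_moment_abs_odd[of 0] by (subst gauss_integral) auto
  ultimately show ?thesis
    by (simp add: nn_integral_eq_integral)
qed

text \<open>Without a penalty, each fixed \<open>w\<close> already contributes \<open>w\<close>
  times the mean of \<open>\<bar>h\<bar>\<close>, and this is unbounded in \<open>w\<close>.\<close>

lemma I1sec_0:
  assumes "0 \<le> \<nu>"
  shows "I1sec q \<nu> 0 = \<top>"
proof (rule ccontr)
  assume "I1sec q \<nu> 0 \<noteq> \<top>"
  then obtain a where a: "I1sec q \<nu> 0 = ennreal a" "0 \<le> a"
    by (cases "I1sec q \<nu> 0") auto
  define w where "w = (a + 1) / sqrt (2 / pi)"
  have w: "0 \<le> w" using a by (simp add: w_def)
  have "ennreal (a + 1) = ennreal w * ennreal (sqrt (2 / pi))"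
    using w by (simp add: w_def flip: ennreal_mult)
  also have "\<dots> = (\<integral>\<^sup>+ h. ennreal w * ennreal \<bar>h\<bar> \<partial>gauss)"
    by (subst nn_integral_cmult) (auto simp: gauss_expectation_abs)
  also have "\<dots> \<le> I1sec q \<nu> 0"
    unfolding I1sec_def
  proof (rule nn_integral_mono)
    fix h :: real
    have "ennreal w * ennreal \<bar>h\<bar> \<le> ennreal (\<bar>h\<bar> * \<bar>w\<bar> + \<nu> * qpow q w - 0 * w\<^sup>2)"
      using w assms qpow_nonneg[of q w] by (simp flip: ennreal_mult) (auto intro!: ennreal_leI simp: mult.commute)
    then show "ennreal w * ennreal \<bar>h\<bar> \<le> (SUP w. ennreal (\<bar>h\<bar> * \<bar>w\<bar> + \<nu> * qpow q w - 0 * w\<^sup>2))"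
      by (rule SUP_upper2[OF UNIV_I])
  qed
  finally show False
    using a by (simp add: ennreal_le_iff)
qed

section \<open>Escape from the cone and recovery\<close>

definition sec_cone :: "real \<Rightarrow> nat \<Rightarrow> nat \<Rightarrow> (nat \<Rightarrow> real) set" where
  "sec_cone q n k = {w. (\<Sum>j<n. (w j)\<^sup>2) = 1 \<and> (\<Sum>j<n - k. qpow q (w j)) \<le> (\<Sum>j=n - k..<n. qpow q (w j))}"

lemma sum_split_at: "(\<Sum>j<n. f j) = (\<Sum>j<n - k. f j) + (\<Sum>j=n - k..<n. f j)" for k n :: nat
  unfolding lessThan_atLeast0 by (rule sum.atLeastLessThan_concat[symmetric]) auto

lemma not_recovers_imp_kernel:
  assumes q: "0 \<le> q" "q \<le> 1" and "\<not> recovers q m n k A"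
  obtains w where "w \<in> sec_cone q n k" "\<And>i. i < m \<Longrightarrow> matvec n A w i = 0"
proof -
  obtain xt x where xt: "\<And>i. i < n - k \<Longrightarrow> xt i = 0"
    and eq: "\<And>i. i < m \<Longrightarrow> matvec n A x i = matvec n A xt i"
    and neq: "\<exists>j<n. x j \<noteq> xt j" and le: "lqq q n x \<le> lqq q n xt"
    using assms(3) unfolding recovers_def not_less[symmetric] by blast
  define d where "d j = x j - xt j" for j
  define N where "N = sqrt (\<Sum>j<n. (d j)\<^sup>2)"
  obtain j where "j < n" "x j \<noteq> xt j"
    using neq by blast
  then have "0 < (\<Sum>j<n. (d j)\<^sup>2)"
    by (intro sum_pos2[of _ j]) (auto simp: d_def)
  then have N: "0 < N" "N\<^sup>2 = (\<Sum>j<n. (d j)\<^sup>2)"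
    by (auto simp: N_def)
  have "qpow q (xt j) \<le> qpow q (x j) + qpow q (d j)" for j
    using qpow_add_le[OF q, of "x j" "- d j"] unfolding qpow_minus by (simp add: d_def)
  then have "(\<Sum>j=n - k..<n. qpow q (xt j)) \<le> (\<Sum>j=n - k..<n. qpow q (x j) + qpow q (d j))"
    by (rule sum_mono)
  moreover have "(\<Sum>j<n - k. qpow q (xt j)) = 0"
    using xt by simp
  moreover have "(\<Sum>j<n - k. qpow q (x j)) = (\<Sum>j<n - k. qpow q (d j))"
    using xt by (simp add: d_def)
  ultimately have cone: "(\<Sum>j<n - k. qpow q (d j)) \<le> (\<Sum>j=n - k..<n. qpow q (d j))"
    using le unfolding lqq_def sum_split_at[of _ n k] sum.distrib by linarith
  show ?thesis
  proof (rule that)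
    have "(\<Sum>j<n. (1 / N * d j)\<^sup>2) = 1"
      unfolding power_mult_distrib sum_distrib_left[symmetric] N(2)[symmetric]
      using N(1) by (simp add: power_divide)
    \<comment> \<open>Multiplicativity of \<open>qpow\<close> makes the cone condition scale
      invariant, also for \<open>q = 0\<close>, so the difference vector may be normalised.\<close>
    moreover have "(\<Sum>j<n - k. qpow q (1 / N * d j)) \<le> (\<Sum>j=n - k..<n. qpow q (1 / N * d j))"
      unfolding qpow_mult sum_distrib_left[symmetric] by (rule mult_left_mono[OF cone qpow_nonneg])
    ultimately show "(\<lambda>j. 1 / N * d j) \<in> sec_cone q n k"
      unfolding sec_cone_def by blast
    show "matvec n A (\<lambda>j. 1 / N * d j) i = 0" if "i < m" for i
    proof -
      have "matvec n A (\<lambda>j. 1 / N * d j) i = 1 / N * (matvec n A x i - matvec n A xt i)"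
        by (simp add: matvec_def d_def sum_distrib_left right_diff_distrib sum_subtractf mult_ac)
      then show ?thesis using eq[OF that] by simp
    qed
  qed
qed

text \<open>Points are grouped by grid cell and one representative of each occupied cell is taken
  from \<open>S\<close> itself, so net points still satisfy the constraints that define
  \<open>S\<close>.\<close>

lemma finite_sup_net:
  fixes S :: "(nat \<Rightarrow> real) set"
  assumes S: "\<And>w j. w \<in> S \<Longrightarrow> j < n \<Longrightarrow> \<bar>w j\<bar> \<le> 1" and \<epsilon>: "0 < \<epsilon>"
  obtains W where "finite W" "W \<subseteq> S" "\<And>w. w \<in> S \<Longrightarrow> \<exists>v\<in>W. \<forall>j<n. \<bar>v j - w j\<bar> \<le> \<epsilon>"
proof -
  define f where "f w = (\<lambda>j\<in>{..<n}. \<lfloor>w j / \<epsilon>\<rfloor>)" for w :: "nat \<Rightarrow> real"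
  define W where "W = inv_into S f ` f ` S"
  have "f ` S \<subseteq> (\<Pi>\<^sub>E j\<in>{..<n}. {\<lfloor>- 1 / \<epsilon>\<rfloor>..\<lfloor>1 / \<epsilon>\<rfloor>})"
  proof (intro image_subsetI)
    fix w assume w: "w \<in> S"
    have "\<lfloor>w j / \<epsilon>\<rfloor> \<in> {\<lfloor>- 1 / \<epsilon>\<rfloor>..\<lfloor>1 / \<epsilon>\<rfloor>}" if "j < n" for j
      using S[OF w that] \<epsilon> divide_right_mono[of "- 1" "w j" \<epsilon>] divide_right_mono[of "w j" 1 \<epsilon>]
      by (auto simp: abs_le_iff intro!: floor_mono)
    then show "f w \<in> (\<Pi>\<^sub>E j\<in>{..<n}. {\<lfloor>- 1 / \<epsilon>\<rfloor>..\<lfloor>1 / \<epsilon>\<rfloor>})"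
      by (auto simp: f_def)
  qed
  then have "finite (f ` S)"
    by (rule finite_subset) (auto intro: finite_PiE)
  then have "finite W" by (simp add: W_def)
  moreover have "W \<subseteq> S" by (auto simp: W_def intro: inv_into_into)
  moreover have "\<exists>v\<in>W. \<forall>j<n. \<bar>v j - w j\<bar> \<le> \<epsilon>" if w: "w \<in> S" for w
  proof (intro bexI allI impI)
    let ?v = "inv_into S f (f w)"
    show "?v \<in> W" using w by (simp add: W_def)
    fix j assume "j < n"
    moreover have "f ?v = f w" using w by (simp add: f_inv_into_f)
    ultimately have "\<lfloor>?v j / \<epsilon>\<rfloor> = \<lfloor>w j / \<epsilon>\<rfloor>"
      by (auto simp: f_def dest: fun_cong[where x = j])
    then have "\<bar>?v j / \<epsilon> - w j / \<epsilon>\<bar> \<le> 1" by linarith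
    then show "\<bar>?v j - w j\<bar> \<le> \<epsilon>"
      using \<epsilon> by (simp add: divide_le_eq flip: diff_divide_distrib)
  qed
  ultimately show ?thesis by (rule that)
qed

text \<open>Markov's inequality for the squared Frobenius norm, whose mean is \<open>m * n\<close>.
  This crude bound suffices because the mesh of the net may depend on \<open>R\<close> in any
  way.\<close>

lemma gauss_matrix_frobenius_tail:
  assumes R: "0 < R"
  shows "measure (gauss_matrix m n) {A \<in> space (gauss_matrix m n). R \<le> (\<Sum>k\<in>{..<m} \<times> {..<n}. (A k)\<^sup>2)} \<le> real (m * n) / R"
proof -
  let ?G = "gauss_matrix m n" and ?I = "{..<m} \<times> {..<n}"
  have "has_bochner_integral ?G (\<lambda>A. (A k)\<^sup>2) 1" if "k \<in> ?I" for k
  proof -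
    have "integrable gauss (\<lambda>z. z\<^sup>2)" "(\<integral>z. z\<^sup>2 \<partial>gauss) = 1"
      using integral_std_normal_moment_even[of 1] integrable_std_normal_moment[of 2]
      by (auto simp: gauss_integral gauss_integrable_iff)
    then show ?thesis
      using gauss_PiM_prod_subset[of ?I "{k}" "\<lambda>_ z. z\<^sup>2"] that
      by (simp add: gauss_matrix_def)
  qed
  then have int: "has_bochner_integral ?G (\<lambda>A. \<Sum>k\<in>?I. (A k)\<^sup>2) (\<Sum>k\<in>?I. 1)"
    by (rule has_bochner_integral_sum)
  have "measure ?G {A \<in> space ?G. R \<le> (\<Sum>k\<in>?I. (A k)\<^sup>2)} \<le> (\<integral>A. (\<Sum>k\<in>?I. (A k)\<^sup>2) \<partial>?G) / R"
    using int R by (intro integral_Markov_inequality_measure[where A = "{}"]) (auto intro!: AE_I2 sum_nonneg dest: integrable.intros)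
  then show ?thesis
    using has_bochner_integral_integral_eq[OF int] by simp
qed

text \<open>The estimate for a net does not involve its cardinality, so the mesh can be taken as
  fine as a prescribed error \<open>\<eta>\<close> demands. The exceptional set consists of matrices
  with a small image on the net and matrices with large entries.\<close>

lemma gordon_escape:
  fixes S :: "(nat \<Rightarrow> real) set" and \<phi> :: "nat \<Rightarrow> real \<Rightarrow> real"
  assumes unit: "\<And>w. w \<in> S \<Longrightarrow> (\<Sum>j<n. (w j)\<^sup>2) = 1"
    and c: "0 < c" and t: "0 \<le> t" and b: "0 \<le> b" and \<eta>: "0 < \<eta>"
    and \<phi>: "\<And>w h. w \<in> S \<Longrightarrow> - (\<Sum>j<n. h j * w j) \<le> \<Gamma> + (\<Sum>j<n. \<phi> j (h j))"
    and \<phi>_int: "\<And>j. j < n \<Longrightarrow> integrable gauss (\<lambda>z. exp (c * \<phi> j z))"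
  obtains E where "E \<in> sets (gauss_matrix m n)"
    "\<And>A w. A \<in> E \<Longrightarrow> w \<in> S \<Longrightarrow> \<exists>i<m. matvec n A w i \<noteq> 0"
    "measure (gauss_matrix m n) E \<ge> 1 - exp 3 * ((exp (- c * b) + exp (t * b\<^sup>2) * (\<integral>z. exp (- t * z\<^sup>2) \<partial>gauss) ^ m)
        * (exp (c * \<Gamma>) * (\<Prod>j<n. \<integral>z. exp (c * \<phi> j z) \<partial>gauss))) - \<eta>"
proof -
  let ?G = "gauss_matrix m n" and ?I = "{..<m} \<times> {..<n}"
  let ?R = "exp 3 * ((exp (- c * b) + exp (t * b\<^sup>2) * (\<integral>z. exp (- t * z\<^sup>2) \<partial>gauss) ^ m)
        * (exp (c * \<Gamma>) * (\<Prod>j<n. \<integral>z. exp (c * \<phi> j z) \<partial>gauss)))"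
  interpret G: prob_space ?G by (rule prob_space_gauss_matrix)
  \<comment> \<open>The Markov bound becomes at most \<open>\<eta>\<close>; the added 1 keeps
    \<open>R\<close> positive when the matrix is empty.\<close>
  define R where "R = real (m * n) / \<eta> + 1"
  have R: "0 < R" using \<eta> by (simp add: R_def add_nonneg_pos)
  have R_\<eta>: "real (m * n) / R \<le> \<eta>"
    using R \<eta> by (simp add: R_def field_simps)
  \<comment> \<open>Replacing a kernel vector by its net point then gives an image of norm at most
    \<open>1 / c\<close>, the tolerance in the net estimate.\<close>
  define \<epsilon> where "\<epsilon> = 1 / (c * (real m + 1) * (real n + 1) * sqrt R)"
  have \<epsilon>: "0 < \<epsilon>" using R c by (simp add: \<epsilon>_def)
  have S_le: "\<bar>w j\<bar> \<le> 1" if "w \<in> S" "j < n" for w j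
  proof -
    have "(w j)\<^sup>2 \<le> (\<Sum>j<n. (w j)\<^sup>2)"
      using that by (intro member_le_sum) auto
    then show ?thesis using unit[OF that(1)] by (simp add: abs_square_le_1)
  qed
  obtain W where W: "finite W" "W \<subseteq> S" "\<And>w. w \<in> S \<Longrightarrow> \<exists>v\<in>W. \<forall>j<n. \<bar>v j - w j\<bar> \<le> \<epsilon>"
    by (rule finite_sup_net[of S n \<epsilon>]) (use S_le \<epsilon> in blast)+
  define B where "B = {A \<in> space ?G. \<exists>w\<in>W. (\<Sum>i<m. (matvec n A w i)\<^sup>2) \<le> (1 / c)\<^sup>2}"
  define C where "C = {A \<in> space ?G. R \<le> (\<Sum>k\<in>?I. (A k)\<^sup>2)}"
  have B: "B \<in> sets ?G"
    unfolding B_def using W(1) by measurable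
  have "(\<lambda>A. \<Sum>k\<in>?I. (A k)\<^sup>2) \<in> borel_measurable ?G"
    by (intro borel_measurable_sum borel_measurable_power) (auto intro: gauss_matrix_measurable_component)
  then have C: "C \<in> sets ?G"
    unfolding C_def by measurable
  have R_nonneg: "0 \<le> ?R"
    by (intro mult_nonneg_nonneg add_nonneg_nonneg zero_le_power prod_nonneg) (auto intro!: integral_nonneg_AE)
  have "measure ?G B \<le> ?R"
  proof (cases "W = {}")
    case True
    then show ?thesis using R_nonneg by (simp add: B_def)
  next
    case False
    show ?thesis
      unfolding B_def
      by (rule gordon_escape_net[OF W(1) False _ c _ _ t b]) (use W(2) unit \<phi> \<phi>_int c in auto)
  qed
  moreover have "measure ?G C \<le> \<eta>"
    using gauss_matrix_frobenius_tail[OF R, of m n] R_\<eta> unfolding C_def by linarith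
  moreover have "measure ?G (B \<union> C) \<le> measure ?G B + measure ?G C"
    using B C by (rule measure_Un_le)
  ultimately have "1 - ?R - \<eta> \<le> measure ?G (space ?G - (B \<union> C))"
    using B C by (subst G.prob_compl) auto
  moreover have "\<exists>i<m. matvec n A w i \<noteq> 0" if A: "A \<in> space ?G - (B \<union> C)" and w: "w \<in> S" for A w
  proof (rule ccontr)
    assume "\<not> (\<exists>i<m. matvec n A w i \<noteq> 0)"
    then have zero: "matvec n A w i = 0" if "i < m" for i using that by blast
    obtain v where v: "v \<in> W" "\<And>j. j < n \<Longrightarrow> \<bar>v j - w j\<bar> \<le> \<epsilon>" using W(3)[OF w] by blast
    have A_le: "\<bar>A (i, j)\<bar> \<le> sqrt R" if "i < m" "j < n" for i j
    proof -
      have "(A (i, j))\<^sup>2 \<le> (\<Sum>k\<in>?I. (A k)\<^sup>2)"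
        using that by (intro member_le_sum) auto
      also have "\<dots> \<le> R" using A by (auto simp: C_def)
      finally show ?thesis by (intro real_le_rsqrt) simp
    qed
    have row: "\<bar>matvec n A v i\<bar> \<le> n * (sqrt R * \<epsilon>)" if i: "i < m" for i
    proof -
      have "matvec n A v i = matvec n A v i - matvec n A w i" using zero[OF i] by simp
      also have "\<dots> = (\<Sum>j<n. A (i, j) * (v j - w j))"
        by (simp add: matvec_def right_diff_distrib sum_subtractf)
      finally have "\<bar>matvec n A v i\<bar> \<le> (\<Sum>j<n. \<bar>A (i, j) * (v j - w j)\<bar>)"
        by simp
      also have "\<dots> \<le> (\<Sum>j<n. sqrt R * \<epsilon>)"
        unfolding abs_mult using A_le[OF i] v(2) R by (intro sum_mono mult_mono) auto
      finally show ?thesis by simp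
    qed
    have "(\<Sum>i<m. (matvec n A v i)\<^sup>2) \<le> (\<Sum>i<m. (n * (sqrt R * \<epsilon>))\<^sup>2)"
    proof (rule sum_mono)
      fix i assume "i \<in> {..<m}"
      then show "(matvec n A v i)\<^sup>2 \<le> (n * (sqrt R * \<epsilon>))\<^sup>2"
        using power_mono[OF row, of i 2] by simp
    qed
    also have "\<dots> = m * (n * (sqrt R * \<epsilon>))\<^sup>2" by simp
    also have "\<dots> \<le> (real m + 1)\<^sup>2 * ((real n + 1) * (sqrt R * \<epsilon>))\<^sup>2"
      using R \<epsilon> by (intro mult_mono power_mono mult_right_mono) (auto simp: power2_sum)
    also have "\<dots> = (1 / c)\<^sup>2"
    proof -
      have "M * (L * (u * (1 / (c * M * L * u)))) = 1 / c" if "0 < M" "0 < L" "0 < u" for M L u :: real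
        using that c by (simp add: field_simps)
      from this[of "real m + 1" "real n + 1" "sqrt R"] show ?thesis
        using R unfolding \<epsilon>_def power_mult_distrib[symmetric] by simp
    qed
    finally show False
      using A v(1) by (auto simp: B_def)
  qed
  ultimately show ?thesis
    using B C by (intro that[of "space ?G - (B \<union> C)"]) auto
qed

text \<open>Weak Lagrangian duality: \<open>\<nu>\<close> prices the cone inequality and
  \<open>\<gamma>\<close> the unit norm, after which the maximum separates into coordinates. The
  rescaling \<open>sqrt n * w j\<close> brings typical coordinates to order one, so the multipliers
  do not depend on \<open>n\<close>.\<close>

lemma sec_cone_width:
  assumes q: "0 \<le> q" "q \<le> 1" and \<gamma>: "0 < \<gamma>" and \<nu>: "0 \<le> \<nu>" and n: "0 < n"
    and w: "w \<in> sec_cone q n k"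
  shows "- (\<Sum>j<n. h j * w j) \<le> \<gamma> * sqrt n
    + (\<Sum>j<n. secmax q (if j < n - k then - \<nu> else \<nu>) \<gamma> \<bar>h j\<bar> / sqrt n)"
proof -
  define \<kappa> where "\<kappa> j = (if j < n - k then - \<nu> else \<nu>)" for j
  have unit: "(\<Sum>j<n. (w j)\<^sup>2) = 1" and cone: "(\<Sum>j<n - k. qpow q (w j)) \<le> (\<Sum>j=n - k..<n. qpow q (w j))"
    using w by (auto simp: sec_cone_def)
  have "0 \<le> qpow q (sqrt n) * (\<nu> * ((\<Sum>j=n - k..<n. qpow q (w j)) - (\<Sum>j<n - k. qpow q (w j))))"
    using cone \<nu> by (intro mult_nonneg_nonneg qpow_nonneg) auto
  also have "\<nu> * ((\<Sum>j=n - k..<n. qpow q (w j)) - (\<Sum>j<n - k. qpow q (w j))) = (\<Sum>j<n. \<kappa> j * qpow q (w j))"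
    unfolding sum_split_at[of _ n k] by (simp add: \<kappa>_def sum_negf right_diff_distrib sum_distrib_left)
  finally have pos: "0 \<le> (\<Sum>j<n. \<kappa> j * qpow q (sqrt n * w j))"
    by (simp add: qpow_mult sum_distrib_left mult_ac)
  have "- sqrt n * (\<Sum>j<n. h j * w j) = (\<Sum>j<n. - sqrt n * (h j * w j))"
    by (simp add: sum_distrib_left)
  also have "\<dots> \<le> (\<Sum>j<n. \<bar>h j\<bar> * \<bar>sqrt n * w j\<bar>)"
  proof (rule sum_mono)
    fix j
    have "- (h j * w j) \<le> \<bar>h j\<bar> * \<bar>w j\<bar>" by (simp flip: abs_mult)
    then have "sqrt n * - (h j * w j) \<le> sqrt n * (\<bar>h j\<bar> * \<bar>w j\<bar>)" by (intro mult_left_mono) auto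
    then show "- sqrt n * (h j * w j) \<le> \<bar>h j\<bar> * \<bar>sqrt n * w j\<bar>" by (simp add: abs_mult mult_ac)
  qed
  also have "\<dots> \<le> (\<Sum>j<n. secmax q (\<kappa> j) \<gamma> \<bar>h j\<bar> - \<kappa> j * qpow q (sqrt n * w j) + \<gamma> * (sqrt n * w j)\<^sup>2)"
    using secmax_ge[OF q \<gamma>] by (intro sum_mono) (smt (verit))
  also have "\<dots> = (\<Sum>j<n. secmax q (\<kappa> j) \<gamma> \<bar>h j\<bar>) - (\<Sum>j<n. \<kappa> j * qpow q (sqrt n * w j)) + \<gamma> * n"
    using unit by (simp add: sum.distrib sum_subtractf power_mult_distrib flip: sum_distrib_left)
  finally have "- sqrt n * (\<Sum>j<n. h j * w j) \<le> (\<Sum>j<n. secmax q (\<kappa> j) \<gamma> \<bar>h j\<bar>) + \<gamma> * n"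
    using pos by linarith
  then have "- sqrt n * (\<Sum>j<n. h j * w j) / sqrt n \<le> ((\<Sum>j<n. secmax q (\<kappa> j) \<gamma> \<bar>h j\<bar>) + \<gamma> * n) / sqrt n"
    by (rule divide_right_mono) simp
  moreover have "- sqrt n * (\<Sum>j<n. h j * w j) / sqrt n = - (\<Sum>j<n. h j * w j)"
    using n by simp
  moreover have "\<gamma> * n / sqrt n = \<gamma> * sqrt n"
    using real_div_sqrt[of "real n"] by (metis of_nat_0_le_iff times_divide_eq_right)
  ultimately show ?thesis
    by (simp add: \<kappa>_def add_divide_distrib sum_divide_distrib)
qed

section \<open>Rounding, coordinate moments and the lower chi-square tail\<close>

lemma round_nat_bounds:
  fixes x :: real
  assumes "0 \<le> x"
  shows "x - 1 \<le> real (nat (round x))" "real (nat (round x)) \<le> x + 1"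
proof -
  have "0 \<le> round x" using round_mono[OF assms] by simp
  then have "real (nat (round x)) = of_int (round x)" by simp
  moreover have "\<bar>of_int (round x) - x\<bar> \<le> 1 / 2" by (rule of_int_round_abs_le)
  ultimately show "x - 1 \<le> real (nat (round x))" "real (nat (round x)) \<le> x + 1" by linarith+
qed

lemma secmax_gauss_moment:
  assumes q: "0 \<le> q" "q \<le> 1" and \<gamma>: "0 < \<gamma>"
  obtains s0 K where "0 < s0" "0 \<le> K" "integrable gauss (\<lambda>h. secmax q \<kappa> \<gamma> \<bar>h\<bar>)"
    "\<And>s. 0 \<le> s \<Longrightarrow> s \<le> s0 \<Longrightarrow> integrable gauss (\<lambda>h. exp (s * secmax q \<kappa> \<gamma> \<bar>h\<bar>))"
    "\<And>s. 0 \<le> s \<Longrightarrow> s \<le> s0 \<Longrightarrow> (\<integral>h. exp (s * secmax q \<kappa> \<gamma> \<bar>h\<bar>) \<partial>gauss)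
      \<le> exp (s * (\<integral>h. secmax q \<kappa> \<gamma> \<bar>h\<bar> \<partial>gauss) + s\<^sup>2 * K)"
proof (rule gauss_exp_moment[of "\<lambda>h. secmax q \<kappa> \<gamma> \<bar>h\<bar>" "\<bar>\<kappa>\<bar> + \<kappa>\<^sup>2 / (2 * \<gamma>)" "1 / (2 * \<gamma>)"])
  note [measurable] = secmax_measurable[OF q \<gamma>]
  show "(\<lambda>h. secmax q \<kappa> \<gamma> \<bar>h\<bar>) \<in> borel_measurable borel" by measurable
  show "0 \<le> secmax q \<kappa> \<gamma> \<bar>h\<bar>" for h by (rule secmax_nonneg[OF q \<gamma>])
  show "secmax q \<kappa> \<gamma> \<bar>h\<bar> \<le> \<bar>\<kappa>\<bar> + \<kappa>\<^sup>2 / (2 * \<gamma>) + 1 / (2 * \<gamma>) * h\<^sup>2" for h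
    using secmax_le[OF q \<gamma>, of \<kappa> "\<bar>h\<bar>"] by simp
  show "0 < 1 / (2 * \<gamma>)" using \<gamma> by simp
qed (rule that)

lemma nn_integral_secmax:
  assumes "0 \<le> q" "q \<le> 1" "0 < \<gamma>"
  shows "(\<integral>\<^sup>+ h. (SUP w::real. ennreal (\<bar>h\<bar> * \<bar>w\<bar> + \<kappa> * qpow q w - \<gamma> * w\<^sup>2)) \<partial>gauss)
    = ennreal (\<integral>h. secmax q \<kappa> \<gamma> \<bar>h\<bar> \<partial>gauss)"
proof -
  have "integrable gauss (\<lambda>h. secmax q \<kappa> \<gamma> \<bar>h\<bar>)"
    by (rule secmax_gauss_moment[OF assms]) 
  then show ?thesis
    using assms by (simp add: nn_integral_eq_integral secmax_nonneg flip: ennreal_secmax)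
qed

text \<open>Per row the exponent is \<open>(\<epsilon> / 2) * (1 - 2 * \<epsilon>) - \<epsilon> / 2
  + 3 / 8 * \<epsilon>\<^sup>2\<close>, which equals \<open>- 5 / 8 * \<epsilon>\<^sup>2\<close> and
  is weakened to a round constant.\<close>

lemma chi_square_tail_le:
  assumes \<epsilon>: "0 \<le> \<epsilon>"
  shows "exp (\<epsilon> / 2 * ((1 - 2 * \<epsilon>) * m)) * (\<integral>z. exp (- (\<epsilon> / 2) * z\<^sup>2) \<partial>gauss) ^ m
    \<le> exp (- (\<epsilon>\<^sup>2 / 2) * real m)"
proof -
  have "(\<integral>z. exp (- (\<epsilon> / 2) * z\<^sup>2) \<partial>gauss) ^ m \<le> exp (- (\<epsilon> / 2) + 3 / 2 * (\<epsilon> / 2)\<^sup>2) ^ m"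
    using \<epsilon> by (intro power_mono gauss_exp_minus_square_le integral_nonneg_AE) auto
  then have "exp (\<epsilon> / 2 * ((1 - 2 * \<epsilon>) * m)) * (\<integral>z. exp (- (\<epsilon> / 2) * z\<^sup>2) \<partial>gauss) ^ m
      \<le> exp (\<epsilon> / 2 * ((1 - 2 * \<epsilon>) * m)) * exp (- (\<epsilon> / 2) + 3 / 2 * (\<epsilon> / 2)\<^sup>2) ^ m"
    by (intro mult_left_mono) auto
  also have "\<dots> = exp (- (5 / 8 * \<epsilon>\<^sup>2) * m)"
    unfolding exp_of_nat_mult[symmetric] exp_add[symmetric]
    by (simp add: power2_eq_square field_simps)
  also have "\<dots> \<le> exp (- (\<epsilon>\<^sup>2 / 2) * real m)"
    by (simp add: mult_right_mono)
  finally show ?thesis .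
qed

text \<open>Recovery quantifies over uncountably many vectors, so its measurability is not evident;
  the probability bound is carried by a measurable event \<open>E\<close> inside the recovery
  event.\<close>

theorem theorem3:
  fixes q \<alpha> \<beta> :: real
  assumes "0 \<le> q" "q \<le> 1"
    and "0 < \<alpha>" "\<alpha> \<le> 1"
    and "0 < \<beta>" "\<beta> < 1"
    and "(INF p \<in> {0..} \<times> {0..}. ennreal \<beta> * I1sec q (fst p) (snd p)
            + ennreal (1 - \<beta>) * I2sec q (fst p) (snd p) + ennreal (snd p))
         < ennreal (sqrt \<alpha>)"
  shows "\<exists>c>0. \<exists>N. \<forall>n\<ge>N.
           \<exists>E \<in> sets (gauss_matrix (nat (round (\<alpha> * real n))) n).
             E \<subseteq> {A \<in> space (gauss_matrix (nat (round (\<alpha> * real n))) n).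
                    recovers q (nat (round (\<alpha> * real n))) n (nat (round (\<beta> * real n))) A}
           \<and> measure (gauss_matrix (nat (round (\<alpha> * real n))) n) E \<ge> 1 - exp (- c * real n)"
proof -
  note q = assms(1,2)
  obtain \<nu> \<gamma> where \<nu>: "0 \<le> \<nu>" and "0 \<le> \<gamma>" and less:
    "ennreal \<beta> * I1sec q \<nu> \<gamma> + ennreal (1 - \<beta>) * I2sec q \<nu> \<gamma> + ennreal \<gamma> < ennreal (sqrt \<alpha>)"
    using assms(7) by (auto simp: INF_less_iff)
  have "\<gamma> \<noteq> 0"
    using less I1sec_0[OF \<nu>, of q] assms(5) by (auto simp: ennreal_mult_top)
  with \<open>0 \<le> \<gamma>\<close> have \<gamma>: "0 < \<gamma>" by simp
  define \<phi> where "\<phi> \<kappa> h = secmax q \<kappa> \<gamma> \<bar>h\<bar>" for \<kappa> h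
  define a where "a \<kappa> = (\<integral>h. \<phi> \<kappa> h \<partial>gauss)" for \<kappa>
  have a_nonneg: "0 \<le> a \<kappa>" for \<kappa>
    by (simp add: a_def \<phi>_def integral_nonneg_AE secmax_nonneg[OF q \<gamma>])
  define \<theta> where "\<theta> = \<beta> * a \<nu> + (1 - \<beta>) * a (- \<nu>) + \<gamma>"
  have \<theta>_pos: "0 < \<theta>"
    using assms(5,6) a_nonneg \<gamma> by (simp add: \<theta>_def add_nonneg_pos)
  have "ennreal \<theta> < ennreal (sqrt \<alpha>)"
    using less nn_integral_secmax[OF q \<gamma>, of \<nu>] nn_integral_secmax[OF q \<gamma>, of "- \<nu>"] assms(5,6) a_nonneg \<gamma>
    by (simp add: I1sec_def I2sec_def \<theta>_def a_def \<phi>_def ennreal_mult ennreal_plus)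
  then have \<theta>: "\<theta> < sqrt \<alpha>"
    using \<theta>_pos by (simp add: ennreal_less_iff)
  \<comment> \<open>The midpoint splits the slack: \<open>\<tau> - \<theta>\<close> pays for the
    second-order terms in \<open>s\<close>, and \<open>sqrt \<alpha> - \<tau>\<close> pays for the
    fluctuation of the norm of g and the rounding of m.\<close>
  define \<tau> where "\<tau> = (\<theta> + sqrt \<alpha>) / 2"
  have \<tau>: "\<theta> < \<tau>" "\<tau> < sqrt \<alpha>" "0 < \<tau>" using \<theta> \<theta>_pos by (auto simp: \<tau>_def)
  have \<tau>2: "\<tau>\<^sup>2 < \<alpha>"
    using power_strict_mono[OF \<tau>(2), of 2] \<tau>(3) assms(3) by simp
  define g where "g = \<tau> - \<theta>"
  have g: "0 < g" using \<tau> by (simp add: g_def)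
  define \<epsilon> where "\<epsilon> = (1 - \<tau>\<^sup>2 / \<alpha>) / 4"
  have \<epsilon>: "0 < \<epsilon>" "\<epsilon> \<le> 1 / 4" and \<epsilon>_\<alpha>: "(1 - 2 * \<epsilon>) * \<alpha> = (\<alpha> + \<tau>\<^sup>2) / 2"
    using \<tau>2 assms(3) by (auto simp: \<epsilon>_def field_simps)
  obtain s1 K1 where s1: "0 < s1" "0 \<le> K1" "\<And>s. 0 \<le> s \<Longrightarrow> s \<le> s1 \<Longrightarrow> integrable gauss (\<lambda>h. exp (s * \<phi> \<nu> h))"
    "\<And>s. 0 \<le> s \<Longrightarrow> s \<le> s1 \<Longrightarrow> (\<integral>h. exp (s * \<phi> \<nu> h) \<partial>gauss) \<le> exp (s * a \<nu> + s\<^sup>2 * K1)"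
    unfolding \<phi>_def a_def by (rule secmax_gauss_moment[OF q \<gamma>, where \<kappa> = \<nu>]) blast
  obtain s2 K2 where s2: "0 < s2" "0 \<le> K2" "\<And>s. 0 \<le> s \<Longrightarrow> s \<le> s2 \<Longrightarrow> integrable gauss (\<lambda>h. exp (s * \<phi> (- \<nu>) h))"
    "\<And>s. 0 \<le> s \<Longrightarrow> s \<le> s2 \<Longrightarrow> (\<integral>h. exp (s * \<phi> (- \<nu>) h) \<partial>gauss) \<le> exp (s * a (- \<nu>) + s\<^sup>2 * K2)"
    unfolding \<phi>_def a_def by (rule secmax_gauss_moment[OF q \<gamma>, where \<kappa> = "- \<nu>"]) blast
  define K where "K = max K1 K2"
  have K: "0 \<le> K" "K1 \<le> K" "K2 \<le> K" using s1 s2 by (auto simp: K_def)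
  \<comment> \<open>The first two bounds keep the moment estimates valid, the third keeps the
    quadratic error below half of the gain \<open>s * g\<close>, and the last keeps the growth of
    the width factor below half of the chi-square decay.\<close>
  define s where "s = min (min s1 s2) (min (g / (2 * (K + 1))) (\<alpha> * \<epsilon>\<^sup>2 / (4 * (\<theta> + g))))"
  have s: "0 < s" "s \<le> s1" "s \<le> s2" "s \<le> g / (2 * (K + 1))" "s \<le> \<alpha> * \<epsilon>\<^sup>2 / (4 * (\<theta> + g))"
    using s1 s2 g K \<epsilon> \<theta>_pos assms(3) by (auto simp: s_def)
  have sK: "s\<^sup>2 * K \<le> s * (g / 2)"
  proof -
    have "s * K \<le> s * (K + 1)" using s by simp
    also have "\<dots> \<le> g / 2" using s(4) K by (simp add: field_simps)
    finally have "s * (s * K) \<le> s * (g / 2)" using s by (intro mult_left_mono) auto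
    then show ?thesis by (simp add: power2_eq_square mult.assoc)
  qed
  have s\<theta>: "s * (\<theta> + g) \<le> \<alpha> * \<epsilon>\<^sup>2 / 4"
    using s(5) \<theta>_pos g by (simp add: field_simps)
  \<comment> \<open>The net decay rates of the two terms:
    \<open>s * \<tau> - s * (\<theta> + g / 2)\<close>, and
    \<open>\<alpha> * \<epsilon>\<^sup>2 / 2\<close> less the quarter consumed by the width
    factor.\<close>
  define \<kappa> where "\<kappa> = min (s * g / 2) (\<alpha> * \<epsilon>\<^sup>2 / 4)"
  have \<kappa>: "0 < \<kappa>" using s g \<epsilon> assms(3) by (simp add: \<kappa>_def)
  \<comment> \<open>The summand 1 covers the rounding of m in the chi-square term, and
    \<open>a \<nu> + a (- \<nu>)\<close> the rounding of k in the two blocks. The final 1 in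
    \<open>C\<close> is for the error of the net argument, later set to
    \<open>exp (- \<kappa> * n)\<close>.\<close>
  define Z where "Z = exp (1 + s * (a \<nu> + a (- \<nu>)))"
  define C where "C = exp 3 * (2 * Z) + 1"
  have C: "1 \<le> C" by (simp add: C_def Z_def)
  have main: "\<exists>E \<in> sets (gauss_matrix (nat (round (\<alpha> * real n))) n).
             E \<subseteq> {A \<in> space (gauss_matrix (nat (round (\<alpha> * real n))) n).
                    recovers q (nat (round (\<alpha> * real n))) n (nat (round (\<beta> * real n))) A}
           \<and> measure (gauss_matrix (nat (round (\<alpha> * real n))) n) E \<ge> 1 - C * exp (- \<kappa> * real n)"
    if n: "0 < n" "2 / (\<alpha> - \<tau>\<^sup>2) \<le> real n" for n
  proof -
    define m k where "m = nat (round (\<alpha> * real n))" and "k = nat (round (\<beta> * real n))"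
    have m: "\<alpha> * n - 1 \<le> real m"
      using round_nat_bounds[of "\<alpha> * real n"] assms(3) by (simp add: m_def)
    have k: "\<beta> * n - 1 \<le> real k" "real k \<le> \<beta> * n + 1"
      using round_nat_bounds[of "\<beta> * real n"] assms(5) by (auto simp: k_def)
    have "round (\<beta> * real n) \<le> round (real n)"
      using assms(6) by (intro round_mono) (simp add: mult_left_le_one_le assms(5) less_imp_le)
    then have k_n: "k \<le> n" by (simp add: k_def)
    define c b where "c = s * sqrt n" and "b = sqrt ((1 - 2 * \<epsilon>) * m)"
    have c: "0 < c" using s n by (simp add: c_def)
    have b: "0 \<le> b" "b\<^sup>2 = (1 - 2 * \<epsilon>) * m" using \<epsilon> by (auto simp: b_def)
    define \<psi> where "\<psi> j h = \<phi> (if j < n - k then - \<nu> else \<nu>) h / sqrt n" for j h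
    have c\<psi>: "c * \<psi> j h = s * \<phi> (if j < n - k then - \<nu> else \<nu>) h" for j h
      using n by (simp add: c_def \<psi>_def)
    have c\<Gamma>: "c * (\<gamma> * sqrt n) = s * \<gamma> * n"
      by (simp add: c_def)
    have \<psi>_int: "integrable gauss (\<lambda>h. exp (c * \<psi> j h))" for j
      unfolding c\<psi> using s s1(3) s2(3) by auto
    have width: "- (\<Sum>j<n. h j * w j) \<le> \<gamma> * sqrt n + (\<Sum>j<n. \<psi> j (h j))" if "w \<in> sec_cone q n k" for w h
      using sec_cone_width[OF q \<gamma> \<nu> n(1) that] by (simp add: \<psi>_def \<phi>_def)
    let ?R = "(exp (- c * b) + exp (\<epsilon> / 2 * b\<^sup>2) * (\<integral>z. exp (- (\<epsilon> / 2) * z\<^sup>2) \<partial>gauss) ^ m)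
        * (exp (c * (\<gamma> * sqrt n)) * (\<Prod>j<n. \<integral>z. exp (c * \<psi> j z) \<partial>gauss))"
    obtain E where E: "E \<in> sets (gauss_matrix m n)"
      "\<And>A w. A \<in> E \<Longrightarrow> w \<in> sec_cone q n k \<Longrightarrow> \<exists>i<m. matvec n A w i \<noteq> 0"
      "measure (gauss_matrix m n) E \<ge> 1 - exp 3 * ?R - exp (- \<kappa> * n)"
    proof (rule gordon_escape[of "sec_cone q n k" n c "\<epsilon> / 2" b "exp (- \<kappa> * n)" "\<gamma> * sqrt n" \<psi> m])
      show "(\<Sum>j<n. (w j)\<^sup>2) = 1" if "w \<in> sec_cone q n k" for w
        using that by (simp add: sec_cone_def)
    qed (use c \<epsilon> b(1) width \<psi>_int in auto)
    have "(\<Prod>j<n. \<integral>z. exp (c * \<psi> j z) \<partial>gauss)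
        \<le> (\<Prod>j<n. exp (s * a (if j < n - k then - \<nu> else \<nu>) + s\<^sup>2 * K))"
    proof (rule prod_mono, intro conjI)
      fix j
      have "(\<integral>z. exp (s * \<phi> \<nu> z) \<partial>gauss) \<le> exp (s * a \<nu> + s\<^sup>2 * K)"
        using s K by (intro order_trans[OF s1(4)]) (auto intro: mult_left_mono)
      moreover have "(\<integral>z. exp (s * \<phi> (- \<nu>) z) \<partial>gauss) \<le> exp (s * a (- \<nu>) + s\<^sup>2 * K)"
        using s K by (intro order_trans[OF s2(4)]) (auto intro: mult_left_mono)
      ultimately show "(\<integral>z. exp (c * \<psi> j z) \<partial>gauss) \<le> exp (s * a (if j < n - k then - \<nu> else \<nu>) + s\<^sup>2 * K)"
        unfolding c\<psi> by simp
    qed (simp add: integral_nonneg_AE)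
    also have "\<dots> = exp (\<Sum>j<n. s * a (if j < n - k then - \<nu> else \<nu>) + s\<^sup>2 * K)"
      by (simp add: exp_sum)
    also have "(\<Sum>j<n. s * a (if j < n - k then - \<nu> else \<nu>) + s\<^sup>2 * K)
        = s * (real (n - k) * a (- \<nu>) + k * a \<nu>) + s\<^sup>2 * K * n"
      using k_n unfolding sum_split_at[of _ n k] by (simp add: distrib_left algebra_simps of_nat_diff)
    also have "exp \<dots> \<le> exp (s * (\<theta> - \<gamma>) * n + s * (a \<nu> + a (- \<nu>)) + s * (g / 2) * n)"
    proof -
      have "real (n - k) * a (- \<nu>) \<le> ((1 - \<beta>) * n + 1) * a (- \<nu>)"
        using k k_n a_nonneg by (intro mult_right_mono) (auto simp: of_nat_diff algebra_simps)
      moreover have "k * a \<nu> \<le> (\<beta> * n + 1) * a \<nu>"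
        using k a_nonneg by (intro mult_right_mono) auto
      ultimately have "real (n - k) * a (- \<nu>) + k * a \<nu> \<le> (\<theta> - \<gamma>) * n + (a \<nu> + a (- \<nu>))"
        by (simp add: \<theta>_def algebra_simps)
      from mult_left_mono[OF this, of s] mult_right_mono[OF sK, of "real n"] s(1) show ?thesis
        by (simp add: algebra_simps)
    qed
    finally have "exp (c * (\<gamma> * sqrt n)) * (\<Prod>j<n. \<integral>z. exp (c * \<psi> j z) \<partial>gauss)
        \<le> exp (c * (\<gamma> * sqrt n)) * exp (s * (\<theta> - \<gamma>) * n + s * (a \<nu> + a (- \<nu>)) + s * (g / 2) * n)"
      by (intro mult_left_mono) auto
    also have "\<dots> = exp (s * (\<theta> + g / 2) * n + s * (a \<nu> + a (- \<nu>)))"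
      unfolding c\<Gamma> exp_add[symmetric] by (simp add: algebra_simps)
    finally have P: "exp (c * (\<gamma> * sqrt n)) * (\<Prod>j<n. \<integral>z. exp (c * \<psi> j z) \<partial>gauss)
        \<le> exp (s * (\<theta> + g / 2) * n + s * (a \<nu> + a (- \<nu>)))" .
    \<comment> \<open>\<open>(1 - 2 * \<epsilon>) * \<alpha>\<close> is the midpoint of
      \<open>\<tau>\<^sup>2\<close> and \<open>\<alpha>\<close>; the lower bound on \<open>n\<close>
      makes the resulting surplus at least 1, enough for the rounding of m.\<close>
    have "s * \<tau> * n \<le> c * b"
    proof -
      have "\<tau>\<^sup>2 * n \<le> (1 - 2 * \<epsilon>) * (\<alpha> * n - 1)"
      proof -
        have "2 \<le> real n * (\<alpha> - \<tau>\<^sup>2)"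
          using n(2) \<tau>2 by (simp add: divide_le_eq)
        then have "\<tau>\<^sup>2 * n + 1 \<le> (1 - 2 * \<epsilon>) * \<alpha> * n"
          unfolding \<epsilon>_\<alpha> by (simp add: field_simps)
        then show ?thesis using \<epsilon> by (simp add: algebra_simps)
      qed
      also have "\<dots> \<le> (1 - 2 * \<epsilon>) * m"
        using \<epsilon> m by (intro mult_left_mono) auto
      finally have "sqrt (\<tau>\<^sup>2 * n) \<le> b"
        unfolding b_def by (rule real_sqrt_le_mono)
      then have "\<tau> * sqrt n \<le> b"
        using \<tau> by (simp add: real_sqrt_mult)
      then have "c * (\<tau> * sqrt n) \<le> c * b"
        using c by (intro mult_left_mono) auto
      moreover have "c * (\<tau> * sqrt n) = s * \<tau> * (sqrt n * sqrt n)"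
        by (simp only: c_def mult_ac)
      ultimately show ?thesis by simp
    qed
    then have T1: "exp (- c * b) \<le> exp (- (s * \<tau> * n))"
      by simp
    have T2: "exp (\<epsilon> / 2 * b\<^sup>2) * (\<integral>z. exp (- (\<epsilon> / 2) * z\<^sup>2) \<partial>gauss) ^ m \<le> exp (- (\<epsilon>\<^sup>2 / 2) * m)"
      unfolding b(2) using \<epsilon> by (intro chi_square_tail_le) auto
    have "?R \<le> (exp (- (s * \<tau> * n)) + exp (- (\<epsilon>\<^sup>2 / 2) * m)) * exp (s * (\<theta> + g / 2) * n + s * (a \<nu> + a (- \<nu>)))"
      using T1 T2 P by (intro mult_mono add_mono mult_nonneg_nonneg prod_nonneg add_nonneg_nonneg) (auto intro!: integral_nonneg_AE)
    also have "\<dots> = exp (- (s * \<tau> * n) + (s * (\<theta> + g / 2) * n + s * (a \<nu> + a (- \<nu>))))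
        + exp (- (\<epsilon>\<^sup>2 / 2) * m + (s * (\<theta> + g / 2) * n + s * (a \<nu> + a (- \<nu>))))"
      by (simp add: distrib_right flip: exp_add)
    also have "\<dots> \<le> Z * exp (- \<kappa> * n) + Z * exp (- \<kappa> * n)"
    proof (rule add_mono)
      have "\<kappa> * n \<le> s * g / 2 * n"
        by (intro mult_right_mono) (auto simp: \<kappa>_def)
      moreover have "s * \<tau> * n = s * \<theta> * n + s * g / 2 * n + s * g / 2 * n"
        by (simp add: g_def algebra_simps)
      moreover have "s * (\<theta> + g / 2) * n = s * \<theta> * n + s * g / 2 * n"
        by (simp add: distrib_left distrib_right)
      ultimately have "- (s * \<tau> * n) + (s * (\<theta> + g / 2) * n + s * (a \<nu> + a (- \<nu>))) \<le> 1 + s * (a \<nu> + a (- \<nu>)) + - \<kappa> * n"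
        by linarith
      then show "exp (- (s * \<tau> * n) + (s * (\<theta> + g / 2) * n + s * (a \<nu> + a (- \<nu>)))) \<le> Z * exp (- \<kappa> * n)"
        unfolding Z_def exp_add[symmetric] by (simp only: exp_le_cancel_iff)
      have "\<epsilon>\<^sup>2 / 2 * (\<alpha> * n - 1) \<le> \<epsilon>\<^sup>2 / 2 * m"
        using m by (intro mult_left_mono) auto
      moreover have "\<epsilon>\<^sup>2 \<le> 1"
        using \<epsilon> by (simp add: power_le_one)
      moreover have "s * (\<theta> + g / 2) * n \<le> \<alpha> * \<epsilon>\<^sup>2 / 4 * n"
      proof (rule mult_right_mono)
        have "s * (\<theta> + g / 2) \<le> s * (\<theta> + g)"
          using s g by (intro mult_left_mono) auto
        with s\<theta> show "s * (\<theta> + g / 2) \<le> \<alpha> * \<epsilon>\<^sup>2 / 4" by simp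
      qed simp
      moreover have "\<kappa> * n \<le> \<alpha> * \<epsilon>\<^sup>2 / 4 * n"
        by (intro mult_right_mono) (auto simp: \<kappa>_def)
      moreover have "\<epsilon>\<^sup>2 / 2 * (\<alpha> * n - 1) = \<alpha> * \<epsilon>\<^sup>2 / 4 * n + \<alpha> * \<epsilon>\<^sup>2 / 4 * n - \<epsilon>\<^sup>2 / 2"
        by (simp add: right_diff_distrib)
      ultimately have "- (\<epsilon>\<^sup>2 / 2) * m + (s * (\<theta> + g / 2) * n + s * (a \<nu> + a (- \<nu>)))
          \<le> 1 + s * (a \<nu> + a (- \<nu>)) + - \<kappa> * n"
        by linarith
      then show "exp (- (\<epsilon>\<^sup>2 / 2) * m + (s * (\<theta> + g / 2) * n + s * (a \<nu> + a (- \<nu>)))) \<le> Z * exp (- \<kappa> * n)"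
        unfolding Z_def exp_add[symmetric] by (simp only: exp_le_cancel_iff)
    qed
    finally have "exp 3 * ?R \<le> exp 3 * (Z * exp (- \<kappa> * n) + Z * exp (- \<kappa> * n))"
      by (intro mult_left_mono) auto
    also have "\<dots> = C * exp (- \<kappa> * n) - exp (- \<kappa> * n)"
      unfolding C_def distrib_right by simp
    finally have "1 - C * exp (- \<kappa> * n) \<le> measure (gauss_matrix m n) E"
      using E(3) by linarith
    moreover have "recovers q m n k A" if "A \<in> E" for A
    proof (rule ccontr)
      assume "\<not> recovers q m n k A"
      then show False
        by (rule not_recovers_imp_kernel[OF q]) (use E(2)[OF that] in blast)
    qed
    moreover have "E \<subseteq> space (gauss_matrix m n)"
      using E(1) by (rule sets.sets_into_space)
    ultimately show ?thesis
      unfolding m_def[symmetric] k_def[symmetric] using E(1) by (intro bexI[of _ E]) auto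
  qed
  \<comment> \<open>Past the second bound the constant \<open>C\<close> is absorbed by giving up
    half of the rate \<open>\<kappa>\<close>.\<close>
  define N where "N = nat \<lceil>max (2 / (\<alpha> - \<tau>\<^sup>2)) (2 * ln C / \<kappa>)\<rceil> + 1"
  show ?thesis
  proof (intro exI[of _ "\<kappa> / 2"] conjI exI[of _ N] allI impI)
    fix n assume "N \<le> n"
    then have n: "0 < n" "2 / (\<alpha> - \<tau>\<^sup>2) \<le> real n" "2 * ln C / \<kappa> \<le> real n"
      by (auto simp: N_def) linarith+
    have "C * exp (- \<kappa> * n) \<le> exp (- (\<kappa> / 2) * n)"
    proof -
      have "ln C \<le> \<kappa> / 2 * n"
        using n(3) \<kappa> by (simp add: field_simps)
      then have "exp (ln C) * exp (- \<kappa> * n) \<le> exp (\<kappa> / 2 * n) * exp (- \<kappa> * n)"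
        by (intro mult_right_mono) auto
      also have "\<dots> = exp (- (\<kappa> / 2) * n)"
        unfolding exp_add[symmetric] by simp
      finally show ?thesis using C by simp
    qed
    moreover obtain E where "E \<in> sets (gauss_matrix (nat (round (\<alpha> * real n))) n)"
      "E \<subseteq> {A \<in> space (gauss_matrix (nat (round (\<alpha> * real n))) n).
         recovers q (nat (round (\<alpha> * real n))) n (nat (round (\<beta> * real n))) A}"
      "1 - C * exp (- \<kappa> * n) \<le> measure (gauss_matrix (nat (round (\<alpha> * real n))) n) E"
      using main[OF n(1,2)] by blast
    ultimately show "\<exists>E \<in> sets (gauss_matrix (nat (round (\<alpha> * real n))) n).
             E \<subseteq> {A \<in> space (gauss_matrix (nat (round (\<alpha> * real n))) n).
                    recovers q (nat (round (\<alpha> * real n))) n (nat (round (\<beta> * real n))) A}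
           \<and> measure (gauss_matrix (nat (round (\<alpha> * real n))) n) E \<ge> 1 - exp (- (\<kappa> / 2) * real n)"
      by (intro bexI[of _ E] conjI) linarith+
  qed (use \<kappa> in simp)
qed

end
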